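(* Let $n,d,m,e,k_{max}$ be positive integers and $\epsilon>0$, and let $C:\{0,1\}^n\times\{0,1\}^d\to\{0,1\}^m$ be a $k\to_\epsilon k+d-e$ condenser for every $k\le k_{max}$ such that $2^k\in\mathbb{N}$. Then the bipartite graph corresponding to $C$ admits $((1-4\epsilon)2^d,\ 2\cdot k_{max}\cdot 2^e)$ online matching up to size $2^{k_{max}}$. If $C$ is explicit, such an assignment function $f(S,x)$ can be computed in time $\mathrm{poly}(2^{k_{max}},2^d,n)$.
   Context: A random variable has min-entropy $k$ if each value has probability at most $2^{-k}$. Random variables $P,Q$ with the same range are $\epsilon$-close if $\sup_T|P(T)-Q(T)|\le\epsilon$. $U_B$ is uniform on $B$. $C$ is a $k\to_\epsilon k'$ condenser if for every random variable $X$ on $\{0,1\}^n$ with min-entropy at least $k$, $C(X,U_{\{0,1\}^d})$ (independent seed) is $\epsilon$-close to a random variable of min-entropy at least $k'$. $C$ is explicit if (as part of a family indexed by $n$) $C(x,y)$ is computable in time polynomial in $n$. The graph corresponding to $C$ has left side $L=\{0,1\}^n$, right side $R=\{0,1\}^m$, and an edge $(x,C(x,\rho))$ for every $x\in\{0,1\}^n$, $\rho\in\{0,1\}^d$ (a multiset; left degree $2^d$). $\mathcal{N}(x)$ is the multiset of neighbors of $x$. Online matching: a graph admits $(\ell,r)$ online matching up to size $K$ if there is a function $f$ assigning to every list $S$ of elements of $L$ of length at most $K$ and every $x\in L$ a multiset $f(S,x)$ over $R$ with: (1) $f(S,x)\subseteq\mathcal{N}(x)$; (2) $f(S,x)=\emptyset$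 if $x\notin S$; (3) if $x\in S$ then $f(S',x)=f(S,x)$ for every list $S'$ of length at most $K$ having $S$ as a prefix; (4) if $x\in S$ then $|f(S,x)|\ge\ell$ (counting multiplicity); (5) every $p\in R$ lies in $f(S,x)$ for at most $r$ distinct $x\in S$.
   Formalization: The algorithm computing f(S,x) is also given the numbers n, d, m, e, k_max and the required size (1-4ε)2^d rounded up; without them the claim fails for families whose parameters are uncomputable functions of n. *)

theory Defs
  imports "HOL-Probability.Probability" "HOL-Computational_Algebra.Polynomial"
begin

definition bitstrings :: "nat \<Rightarrow> bool list set" where
  "bitstrings n = {xs. length xs = n}"

section \<open>Condensers\<close>

text \<open>
  Being an upper bound on all point probabilities, this predicate expresses
  min-entropy \<^emph>\<open>at least\<close> \<open>k\<close>.  The parameter \<open>k\<close> is an arbitrary real number.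
\<close>

definition has_min_entropy :: "real \<Rightarrow> 'a pmf \<Rightarrow> bool" where
  "has_min_entropy k P \<longleftrightarrow> (\<forall>x. pmf P x \<le> 2 powr (- k))"

definition eps_close :: "real \<Rightarrow> 'a pmf \<Rightarrow> 'a pmf \<Rightarrow> bool" where
  "eps_close \<epsilon> P Q \<longleftrightarrow> (SUP T. \<bar>measure_pmf.prob P T - measure_pmf.prob Q T\<bar>) \<le> \<epsilon>"

text \<open>
  A function \<open>C : {0,1}\<^sup>n \<times> {0,1}\<^sup>d \<rightarrow> {0,1}\<^sup>m\<close> is represented by a function on all bit
  strings, of which only the values on the domain matter.
\<close>

definition maps_bitstrings ::
  "nat \<Rightarrow> nat \<Rightarrow> nat \<Rightarrow> (bool list \<Rightarrow> bool list \<Rightarrow> bool list) \<Rightarrow> bool" where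
  "maps_bitstrings n d m C \<longleftrightarrow> (\<forall>x\<in>bitstrings n. \<forall>y\<in>bitstrings d. C x y \<in> bitstrings m)"

definition condenser ::
  "nat \<Rightarrow> nat \<Rightarrow> nat \<Rightarrow> real \<Rightarrow> real \<Rightarrow> real \<Rightarrow> (bool list \<Rightarrow> bool list \<Rightarrow> bool list) \<Rightarrow> bool" where
  "condenser n d m k \<epsilon> k' C \<longleftrightarrow>
     maps_bitstrings n d m C \<and>
     (\<forall>X. set_pmf X \<subseteq> bitstrings n \<longrightarrow> has_min_entropy k X \<longrightarrow>
        (\<exists>Q. set_pmf Q \<subseteq> bitstrings m \<and> has_min_entropy k' Q \<and>
             eps_close \<epsilon> (map_pmf (\<lambda>(x, y). C x y) (pair_pmf X (pmf_of_set (bitstrings d)))) Q))"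

section \<open>Online matching\<close>

definition nbrs ::
  "nat \<Rightarrow> (bool list \<Rightarrow> bool list \<Rightarrow> bool list) \<Rightarrow> bool list \<Rightarrow> bool list multiset" where
  "nbrs d C x = image_mset (C x) (mset_set (bitstrings d))"

text \<open>
  A bipartite multigraph is given by its sides \<open>L\<close>, \<open>R\<close> and the multiset \<open>N x\<close> of
  neighbours of every \<open>x \<in> L\<close>.
\<close>

definition online_assignment ::
  "'a set \<Rightarrow> 'b set \<Rightarrow> ('a \<Rightarrow> 'b multiset) \<Rightarrow> real \<Rightarrow> real \<Rightarrow> nat \<Rightarrow>
    ('a list \<Rightarrow> 'a \<Rightarrow> 'b multiset) \<Rightarrow> bool" where
  "online_assignment L R N l r K f \<longleftrightarrow>
     (\<forall>S. set S \<subseteq> L \<and> length S \<le> K \<longrightarrow>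
        (\<forall>x\<in>L.
           set_mset (f S x) \<subseteq> R \<and>
           f S x \<subseteq># N x \<and>
           (x \<notin> set S \<longrightarrow> f S x = {#}) \<and>
           (x \<in> set S \<longrightarrow>
              (\<forall>T. set (S @ T) \<subseteq> L \<and> length (S @ T) \<le> K \<longrightarrow> f (S @ T) x = f S x)) \<and>
           (x \<in> set S \<longrightarrow> real (size (f S x)) \<ge> l)) \<and>
        (\<forall>p\<in>R. real (card {x \<in> set S. p \<in># f S x}) \<le> r))"

definition admits_online_matching ::
  "'a set \<Rightarrow> 'b set \<Rightarrow> ('a \<Rightarrow> 'b multiset) \<Rightarrow> real \<Rightarrow> real \<Rightarrow> nat \<Rightarrow> bool" where
  "admits_online_matching L R N l r K \<longleftrightarrow> (\<exists>f. online_assignment L R N l r K f)"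

section \<open>Time-bounded computation\<close>

text \<open>
  The model is the WHILE language of N. D. Jones (``Computability and Complexity'', 1997):
  the data are binary trees, and building a pair, taking a component and testing for the
  empty tree cost one unit each.  There is no equality test on trees.  Programs are
  written with a single implicit variable, so that a program denotes a partial function
  on trees; several variables are kept in one tree.  Polynomial time in this model is
  polynomial time on Turing machines.
\<close>

datatype tree = Leaf | Node tree tree

datatype prog =
    Id
  | Quote tree
  | Fst
  | Snd
  | Pair prog prog
  | Seq prog prog
  | Cond prog prog prog
  | While prog prog

text \<open>\<open>runs p v w t\<close>: on input \<open>v\<close>, the program \<open>p\<close> halts with output \<open>w\<close> after \<open>t\<close> steps.\<close>

inductive runs :: "prog \<Rightarrow> tree \<Rightarrow> tree \<Rightarrow> nat \<Rightarrow> bool" where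
  Id: "runs Id v v 1"
| Quote: "runs (Quote c) v c 1"
| Fst_Leaf: "runs Fst Leaf Leaf 1"
| Fst_Node: "runs Fst (Node a b) a 1"
| Snd_Leaf: "runs Snd Leaf Leaf 1"
| Snd_Node: "runs Snd (Node a b) b 1"
| Pair: "runs p v a s \<Longrightarrow> runs q v b t \<Longrightarrow> runs (Pair p q) v (Node a b) (s + t + 1)"
| Seq: "runs p u v s \<Longrightarrow> runs q v w t \<Longrightarrow> runs (Seq p q) u w (s + t + 1)"
| Cond_true: "runs b v (Node c c') s \<Longrightarrow> runs p v w t \<Longrightarrow> runs (Cond b p q) v w (s + t + 1)"
| Cond_false: "runs b v Leaf s \<Longrightarrow> runs q v w t \<Longrightarrow> runs (Cond b p q) v w (s + t + 1)"
| While_true: "runs b u (Node c c') r \<Longrightarrow> runs p u v s \<Longrightarrow> runs (While b p) v w t \<Longrightarrow>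
    runs (While b p) u w (r + s + t + 1)"
| While_false: "runs b u Leaf r \<Longrightarrow> runs (While b p) u u (r + 1)"

definition outputs_within :: "prog \<Rightarrow> tree \<Rightarrow> tree \<Rightarrow> nat \<Rightarrow> bool" where
  "outputs_within p v w T \<longleftrightarrow> (\<exists>t\<le>T. runs p v w t)"

fun enc_list :: "('a \<Rightarrow> tree) \<Rightarrow> 'a list \<Rightarrow> tree" where
  "enc_list enc [] = Leaf"
| "enc_list enc (x # xs) = Node (enc x) (enc_list enc xs)"

fun enc_bit :: "bool \<Rightarrow> tree" where
  "enc_bit False = Leaf"
| "enc_bit True = Node Leaf Leaf"

abbreviation enc_bits :: "bool list \<Rightarrow> tree" where
  "enc_bits \<equiv> enc_list enc_bit"

text \<open>Natural numbers are encoded in unary.\<close>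

definition enc_nat :: "nat \<Rightarrow> tree" where
  "enc_nat n = enc_list (\<lambda>_. Leaf) (replicate n ())"

text \<open>
  A family has one member for every \<open>n\<close> in an index set \<open>I\<close>; its parameters are functions
  of \<open>n\<close>.  The family is explicit if one program computes all members, in time polynomial
  in \<open>n\<close>.  The program can read off \<open>n\<close> and \<open>d n\<close> as the lengths of its inputs.
\<close>

definition explicit_family ::
  "nat set \<Rightarrow> (nat \<Rightarrow> nat) \<Rightarrow> (nat \<Rightarrow> bool list \<Rightarrow> bool list \<Rightarrow> bool list) \<Rightarrow> bool" where
  "explicit_family I d C \<longleftrightarrow>
     (\<exists>P (b :: nat poly). \<forall>n\<in>I. \<forall>x\<in>bitstrings n. \<forall>y\<in>bitstrings (d n).
        outputs_within P (Node (enc_bits x) (enc_bits y)) (enc_bits (C n x y)) (poly b n))"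

text \<open>
  One program computes all functions \<open>f n\<close>, in time polynomial in \<open>2 ^ kmax n\<close>, \<open>2 ^ d n\<close>
  and \<open>n\<close> jointly.  A polynomial bound in several nonnegative quantities amounts to a
  polynomial bound with natural coefficients in their sum.  A multiset is output as a
  list of its elements, in any order.

  The functions giving the parameters need not be computable, so the list \<open>prm n\<close> of
  numerical parameters is part of the input.  A real \<open>\<epsilon>\<close> cannot be passed to a program; what
  is passed in its place is the size required of the assigned multisets, rounded up to a
  natural number, which is the same requirement on a multiset.
\<close>

definition assignment_computable ::
  "nat set \<Rightarrow> (nat \<Rightarrow> nat) \<Rightarrow> (nat \<Rightarrow> nat) \<Rightarrow> (nat \<Rightarrow> nat list) \<Rightarrow>
    (nat \<Rightarrow> bool list list \<Rightarrow> bool list \<Rightarrow> bool list multiset) \<Rightarrow> bool" where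
  "assignment_computable I d kmax prm f \<longleftrightarrow>
     (\<exists>P (b :: nat poly). \<forall>n\<in>I. \<forall>S. \<forall>x\<in>bitstrings n.
        set S \<subseteq> bitstrings n \<and> length S \<le> 2 ^ kmax n \<longrightarrow>
        (\<exists>ys. mset ys = f n S x \<and>
           outputs_within P
             (Node (enc_list enc_nat (prm n)) (Node (enc_list enc_bits S) (enc_bits x)))
             (enc_list enc_bits ys)
             (poly b (2 ^ kmax n + 2 ^ d n + n))))"

section \<open>The hypotheses on the parameters and on the condenser\<close>

text \<open>
  The exponent \<open>k\<close> ranges over the reals for which \<open>2\<^sup>k\<close> is a natural number, that is, over
  the logarithms of the positive integers up to \<open>2 ^ kmax\<close>.
\<close>

definition condenser_up_to ::
  "nat \<Rightarrow> nat \<Rightarrow> nat \<Rightarrow> nat \<Rightarrow> nat \<Rightarrow> real \<Rightarrow> (bool list \<Rightarrow> bool list \<Rightarrow> bool list) \<Rightarrow> bool" where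
  "condenser_up_to n d m e kmax \<epsilon> C \<longleftrightarrow>
     n > 0 \<and> d > 0 \<and> m > 0 \<and> e > 0 \<and> kmax > 0 \<and> \<epsilon> > 0 \<and>
     maps_bitstrings n d m C \<and>
     (\<forall>k::real. k \<le> real kmax \<and> 2 powr k \<in> \<nat> \<longrightarrow>
        condenser n d m k \<epsilon> (k + real d - real e) C)"

end

theory Submission
  imports Defs
begin

text \<open>
  The matching uses \<open>k\<^sub>m\<^sub>a\<^sub>x\<close> copies (levels) of the graph.  On each level a new left node is
  assigned its neighbours of load less than \<open>2 \<cdot> 2\<^sup>e\<close> on this level, provided that there are at
  least \<open>(1 - 4\<epsilon>) 2\<^sup>d\<close> of them, and is otherwise rejected and passed on to the next level.
  Let \<open>S\<close> be the set of nodes that reach a level.  Applied to the uniform distribution on \<open>S\<close>,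
  the condenser property shows that at most a fraction \<open>2\<epsilon>\<close> of the edges leaving \<open>S\<close> lead to
  nodes of full load, while every rejected node has more than a fraction \<open>4\<epsilon>\<close> of such edges.
  Hence fewer than half of the nodes are rejected, and after \<open>k\<^sub>m\<^sub>a\<^sub>x\<close> levels none are left.

  All of this is a bounded nest of loops over lists of length polynomial in \<open>2 ^ k\<^sub>m\<^sub>a\<^sub>x\<close>,
  \<open>2 ^ d\<close> and \<open>n\<close>.
\<close>

section \<open>Greedy matching by levels\<close>

text \<open>A node repeated in one list counts once, because condition (5) of online matching counts
  distinct left nodes and not edges.\<close>

definition load :: "('a \<times> 'b list) list \<Rightarrow> 'b \<Rightarrow> nat" where
  "load A p = length (filter (\<lambda>(x, ps). p \<in> set ps) A)"

fun greedy_step ::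
  "('a \<Rightarrow> 'b list) \<Rightarrow> nat \<Rightarrow> nat \<Rightarrow> 'a \<Rightarrow> ('a \<times> 'b list) list \<times> 'a list \<Rightarrow> ('a \<times> 'b list) list \<times> 'a list" where
  "greedy_step N t l x (A, F) =
     (let ps = filter (\<lambda>p. load A p < t) (N x)
      in if l \<le> length ps then ((x, ps) # A, F) else (A, x # F))"

text \<open>
  Lists are kept with the newest element first, so that extending the input on the right
  prolongs all lists on the left.
\<close>

definition greedy ::
  "('a \<Rightarrow> 'b list) \<Rightarrow> nat \<Rightarrow> nat \<Rightarrow> 'a list \<Rightarrow> ('a \<times> 'b list) list \<times> 'a list" where
  "greedy N t l L = foldr (greedy_step N t l) L ([], [])"

text \<open>The rejected list stays ordered newest first. The order of the entries is immaterial;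
  \<open>rev A @ Z\<close> is what one loop prepending the elements of \<open>A\<close> to
  \<open>Z\<close> produces.\<close>

fun level ::
  "('a \<Rightarrow> 'b list) \<Rightarrow> nat \<Rightarrow> nat \<Rightarrow> 'a list \<times> ('a \<times> 'b list) list \<Rightarrow> 'a list \<times> ('a \<times> 'b list) list" where
  "level N t l (L, Z) = (let (A, F) = greedy N t l L in (F, rev A @ Z))"

text \<open>\<open>fold List.insert\<close> drops repetitions and leaves the newest node first, so a
  node that occurs again later in \<open>S\<close> changes nothing.\<close>

definition levels ::
  "('a \<Rightarrow> 'b list) \<Rightarrow> nat \<Rightarrow> nat \<Rightarrow> nat \<Rightarrow> 'a list \<Rightarrow> 'a list \<times> ('a \<times> 'b list) list" where
  "levels N t l k S = (level N t l ^^ k) (fold List.insert S [], [])"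

text \<open>Written as a left fold so that a single loop computes it. The initial value
  \<open>[]\<close> becomes the empty multiset required for nodes outside \<open>S\<close>.\<close>

definition lookup :: "'a \<Rightarrow> ('a \<times> 'b list) list \<Rightarrow> 'b list" where
  "lookup x Z = fold (\<lambda>(z, ps) out. if z = x then ps else out) Z []"

definition assignment ::
  "('a \<Rightarrow> 'b list) \<Rightarrow> nat \<Rightarrow> nat \<Rightarrow> nat \<Rightarrow> 'a list \<Rightarrow> 'a \<Rightarrow> 'b multiset" where
  "assignment N t l k S x = mset (lookup x (snd (levels N t l k S)))"

lemma load_Nil [simp]: "load [] p = 0"
  and load_Cons [simp]: "load ((x, ps) # A) p = (if p \<in> set ps then 1 else 0) + load A p"
  and load_append [simp]: "load (A @ B) p = load A p + load B p"
  and load_rev [simp]: "load (rev A) p = load A p"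
  by (simp_all add: load_def flip: rev_filter)

lemma lookup_append:
  "lookup x (Z @ [(z, ps)]) = (if z = x then ps else lookup x Z)"
  by (simp add: lookup_def)

lemma lookup_eq:
  assumes "distinct (map fst Z)" "(x, ps) \<in> set Z"
  shows "lookup x Z = ps"
  using assms
  by (induction Z rule: rev_induct) (auto simp: lookup_append rev_image_eqI)

lemma lookup_notin: "x \<notin> fst ` set Z \<Longrightarrow> lookup x Z = []"
  by (induction Z rule: rev_induct) (auto simp: lookup_append, simp add: lookup_def)

section \<open>Properties of a single greedy pass\<close>

lemma greedy_Nil [simp]: "greedy N t l [] = ([], [])"
  and greedy_Cons [simp]: "greedy N t l (x # L) = greedy_step N t l x (greedy N t l L)"
  by (simp_all add: greedy_def)

text \<open>\<open>foldr\<close> starts at the right end, so the older part \<open>L\<close> is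
  settled before \<open>W\<close> is looked at.\<close>

lemma greedy_append:
  assumes "greedy N t l L = (A, F)"
  shows "\<exists>A' F'. greedy N t l (W @ L) = (A' @ A, F' @ F)"
proof (induction W)
  case (Cons w W)
  then obtain A' F' where "greedy N t l (W @ L) = (A' @ A, F' @ F)" by blast
  then show ?case
    by (simp add: Let_def)
qed (use assms in simp)

lemma greedy_mset:
  "greedy N t l L = (A, F) \<Longrightarrow> mset (map fst A) + mset F = mset L"
  by (induction L arbitrary: A F) (auto simp: Let_def split: if_splits prod.splits elim!: greedy_step.elims)

lemma greedy_entries:
  "greedy N t l L = (A, F) \<Longrightarrow> (x, ps) \<in> set A \<Longrightarrow> mset ps \<subseteq># mset (N x) \<and> l \<le> length ps"
  by (induction L arbitrary: A F)
     (auto simp: Let_def multiset_filter_subset split: if_splits prod.splits elim!: greedy_step.elims)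

text \<open>Only nodes of load below \<open>t\<close> are assigned, and one entry raises a load by
  at most one, even if the node is repeated in it.\<close>

lemma greedy_load:
  "greedy N t l L = (A, F) \<Longrightarrow> load A p \<le> t"
  by (induction L arbitrary: A F)
     (auto simp: Let_def Suc_le_eq split: if_splits prod.splits elim!: greedy_step.elims)

text \<open>Loads only grow, so the neighbours still free at the end were already free when
  \<open>x\<close> was rejected.\<close>

lemma greedy_rejected:
  "greedy N t l L = (A, F) \<Longrightarrow> x \<in> set F \<Longrightarrow> length (filter (\<lambda>p. load A p < t) (N x)) < l"
proof (induction L arbitrary: A F)
  case (Cons y L)
  obtain A' F' where g: "greedy N t l L = (A', F')" by fastforce
  have le: "load A' p \<le> load A p" for p
    using Cons.prems(1) g by (auto simp: Let_def split: if_splits)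
  have *: "length (filter (\<lambda>p. load A p < t) (N x)) \<le> length (filter (\<lambda>p. load A' p < t) (N x))"
  proof -
    have "filter (\<lambda>p. load A p < t) (N x) = filter (\<lambda>p. load A p < t) (filter (\<lambda>p. load A' p < t) (N x))"
      using le by (auto simp: filter_filter intro!: filter_cong dest: le_less_trans)
    then show ?thesis by (metis length_filter_le)
  qed
  show ?case
  proof (cases "x \<in> set F'")
    case True
    with Cons.IH[OF g] * show ?thesis by (meson le_less_trans)
  next
    case False
    with Cons.prems g show ?thesis by (auto simp: Let_def split: if_splits)
  qed
qed simp

section \<open>Stability under prolonging the input\<close>

text \<open>New entries of a level land between the old entries of different levels, so the
  collected list is not prolonged at one end. Inclusion of sets survives, and suffices for looking
  up a node when the keys are distinct.\<close>

lemma level_append: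
  assumes "level N t l (L, Z) = (L1, Z1)" "set Z \<subseteq> set Z'"
  shows "\<exists>W1 Z1'. level N t l (W @ L, Z') = (W1 @ L1, Z1') \<and> set Z1 \<subseteq> set Z1'"
proof -
  obtain A F where g: "greedy N t l L = (A, F)" by fastforce
  from greedy_append[OF g, of W] obtain A' F' where "greedy N t l (W @ L) = (A' @ A, F' @ F)"
    by blast
  with assms g show ?thesis by auto
qed

lemma fold_insert_append: "\<exists>W. fold List.insert T L = W @ L"
proof (induction T arbitrary: L)
  case (Cons a T)
  obtain W where "fold List.insert T (List.insert a L) = W @ List.insert a L" using Cons by blast
  moreover have "\<exists>V. List.insert a L = V @ L" by (auto simp: List.insert_def)
  ultimately show ?case by (metis append.assoc fold_simps(2))
qed simp

text \<open>Source of condition (3) of online matching: on every level the nodes contributed by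
  \<open>T\<close> are treated after all older ones, so the entries made for \<open>S\<close>
  persist.\<close>

lemma levels_append:
  assumes "levels N t l k S = (L, Z)"
  shows "\<exists>W Z'. levels N t l k (S @ T) = (W @ L, Z') \<and> set Z \<subseteq> set Z'"
  using assms
proof (induction k arbitrary: L Z)
  case 0
  then show ?case using fold_insert_append[of T "fold List.insert S []"] by (auto simp: levels_def)
next
  case (Suc k)
  obtain L0 Z0 where l0: "levels N t l k S = (L0, Z0)" by fastforce
  from Suc.IH[OF l0] obtain W Z' where
    "levels N t l k (S @ T) = (W @ L0, Z')" "set Z0 \<subseteq> set Z'" by blast
  moreover have "level N t l (L0, Z0) = (L, Z)" using Suc.prems l0 by (simp add: levels_def)
  ultimately show ?case using level_append[of N t l L0 Z0 L Z Z' W] by (simp add: levels_def)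
qed

lemma distinct_fold_insert: "distinct L \<Longrightarrow> distinct (fold List.insert S L)"
  by (induction S arbitrary: L) auto

lemma set_fold_insert: "set (fold List.insert S L) = set S \<union> set L"
  by (induction S arbitrary: L) auto

lemma length_fold_insert: "length (fold List.insert S L) \<le> length S + length L"
proof (induction S arbitrary: L)
  case (Cons a S)
  show ?case using Cons[of "List.insert a L"] by (simp add: List.insert_def split: if_splits)
qed simp

section \<open>Invariants over all levels and the online matching\<close>

text \<open>A level moves each node of its list either to the entries or to the rejected list, and
  adds at most \<open>t\<close> to any load.\<close>

lemma levels_invariants:
  assumes "levels N t l k S = (L, Z)"
  shows "mset (map fst Z) + mset L = mset (fold List.insert S [])"
    and "\<And>x ps. (x, ps) \<in> set Z \<Longrightarrow> mset ps \<subseteq># mset (N x) \<and> l \<le> length ps"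
    and "load Z p \<le> k * t"
proof -
  have "mset (map fst Z) + mset L = mset (fold List.insert S []) \<and>
    (\<forall>(x, ps) \<in> set Z. mset ps \<subseteq># mset (N x) \<and> l \<le> length ps) \<and> load Z p \<le> k * t"
    using assms
  proof (induction k arbitrary: L Z)
    case 0
    then show ?case by (auto simp: levels_def)
  next
    case (Suc k)
    obtain L0 Z0 where l0: "levels N t l k S = (L0, Z0)" by fastforce
    obtain A F where g: "greedy N t l L0 = (A, F)" by fastforce
    have "L = F" "Z = rev A @ Z0" using Suc.prems l0 g by (simp_all add: levels_def)
    moreover have "load Z0 p + load A p \<le> k * t + t"
      using Suc.IH[OF l0] greedy_load[OF g, of p] by (simp add: add_mono)
    moreover have "mset (map fst Z) + mset L = mset (fold List.insert S [])"
      using Suc.IH[OF l0] greedy_mset[OF g, symmetric] \<open>L = F\<close> \<open>Z = rev A @ Z0\<close> by (simp add: ac_simps)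
    moreover have "\<forall>(x, ps) \<in> set A. mset ps \<subseteq># mset (N x) \<and> l \<le> length ps"
      using greedy_entries[OF g] by blast
    ultimately show ?case
      using Suc.IH[OF l0] \<open>Z = rev A @ Z0\<close> by (auto simp: ac_simps)
  qed
  then show "mset (map fst Z) + mset L = mset (fold List.insert S [])"
    and "\<And>x ps. (x, ps) \<in> set Z \<Longrightarrow> mset ps \<subseteq># mset (N x) \<and> l \<le> length ps"
    and "load Z p \<le> k * t" by auto
qed

lemma levels_lengths:
  assumes "levels N t l k S = (L, Z)"
  shows "set L \<subseteq> set S" "fst ` set Z \<subseteq> set S" "length L \<le> length S" "length Z \<le> length S"
proof -
  have ms: "mset (map fst Z @ L) = mset (fold List.insert S [])"
    using levels_invariants(1)[OF assms] by simp
  from mset_eq_setD[OF this] show "set L \<subseteq> set S" "fst ` set Z \<subseteq> set S"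
    by (auto simp: set_fold_insert)
  from mset_eq_length[OF ms] length_fold_insert[of S "[]"] show "length L \<le> length S" "length Z \<le> length S"
    by auto
qed

text \<open>The condenser enters only through \<open>shrink\<close>. Each pass rejects fewer than
  half of at most \<open>2 ^ k\<close> nodes, so after \<open>k\<close> passes every node has its
  entry.\<close>

lemma online_assignment_assignment:
  assumes k: "k > 0"
    and N: "\<And>x. x \<in> X \<Longrightarrow> mset (N x) = M x" "\<And>x. x \<in> X \<Longrightarrow> set (N x) \<subseteq> R"
    and l: "l' \<le> real l" and r: "real (k * t) \<le> r"
    and shrink: "\<And>L A F. set L \<subseteq> X \<Longrightarrow> distinct L \<Longrightarrow> length L \<le> 2 ^ k \<Longrightarrow> L \<noteq> [] \<Longrightarrow>
      greedy N t l L = (A, F) \<Longrightarrow> 2 * length F < length L"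
  shows "online_assignment X R M l' r (2 ^ k) (assignment N t l k)"
proof -
  have facts: "distinct (map fst (snd (levels N t l k S)))"
    "fst ` set (snd (levels N t l k S)) = set S"
    if S: "set S \<subseteq> X" "length S \<le> 2 ^ k" for S
  proof -
    let ?D = "fold List.insert S []"
    have D: "distinct ?D" "set ?D = set S" "length ?D \<le> 2 ^ k"
      using S(2) length_fold_insert[of S "[]"] by (simp_all add: distinct_fold_insert set_fold_insert)
    have inv: "distinct (map fst Z @ L) \<and> set (map fst Z @ L) = set S"
      if "levels N t l i S = (L, Z)" for i L Z
    proof -
      have "mset (map fst Z @ L) = mset ?D" using levels_invariants(1)[OF that] by simp
      then show ?thesis by (metis D(1,2) mset_eq_imp_distinct_iff mset_eq_setD)
    qed
    \<comment> \<open>The inequality is strict from the first level on. At \<open>i = k > 0\<close>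
      it forces the list of rejected nodes to be empty.\<close>
    have short: "length (fst (levels N t l i S)) * 2 ^ i \<le> 2 ^ k \<and>
        (i > 0 \<longrightarrow> length (fst (levels N t l i S)) * 2 ^ i < 2 ^ k)" for i
    proof (induction i)
      case 0
      then show ?case using D by (simp add: levels_def)
    next
      case (Suc i)
      obtain L Z where lv: "levels N t l i S = (L, Z)" by fastforce
      obtain A F where g: "greedy N t l L = (A, F)" by fastforce
      have F: "fst (levels N t l (Suc i) S) = F" using lv g by (simp add: levels_def)
      have "length L \<le> length L * 2 ^ i" by simp
      then have len: "length L \<le> 2 ^ k" using Suc lv by (metis fst_conv le_trans)
      show ?case
      proof (cases "L = []")
        case True
        then show ?thesis using F g by simp
      next
        case False
        have "2 * length F < length L"
          using shrink[OF _ _ len False g] inv[OF lv] S(1) by auto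
        then have "length F * 2 ^ Suc i < length L * 2 ^ i" by simp
        then have "length F * 2 ^ Suc i < 2 ^ k" using Suc lv by (metis fst_conv less_le_trans)
        then show ?thesis using F by simp
      qed
    qed
    obtain L Z where lv: "levels N t l k S = (L, Z)" by fastforce
    have "L = []" using short[of k] lv k by simp
    with inv[OF lv] lv show "distinct (map fst (snd (levels N t l k S)))"
      "fst ` set (snd (levels N t l k S)) = set S" by simp_all
  qed
  show ?thesis
    unfolding online_assignment_def
  proof (intro allI impI ballI conjI; elim conjE)
    fix S assume S: "set S \<subseteq> X" "length S \<le> 2 ^ k"
    let ?Z = "snd (levels N t l k S)"
    have lk: "\<exists>ps. (x, ps) \<in> set ?Z \<and> lookup x ?Z = ps \<and> mset ps \<subseteq># mset (N x) \<and> l \<le> length ps"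
      if "x \<in> set S" for x
    proof -
      have "x \<in> fst ` set ?Z" using that facts(2)[OF S] by simp
      then obtain ps where ps: "(x, ps) \<in> set ?Z" by auto
      then show ?thesis
        using lookup_eq[OF facts(1)[OF S] ps] levels_invariants(2)[OF surjective_pairing ps] by auto
    qed
    show "real (card {x \<in> set S. p \<in># assignment N t l k S x}) \<le> r" if "p \<in> R" for p
    proof -
      have "{x \<in> set S. p \<in># assignment N t l k S x} \<subseteq> fst ` set (filter (\<lambda>(x, ps). p \<in> set ps) ?Z)"
        using lk by (force simp: assignment_def)
      then have "card {x \<in> set S. p \<in># assignment N t l k S x}
          \<le> card (set (map fst (filter (\<lambda>(x, ps). p \<in> set ps) ?Z)))"
        by (intro card_mono) auto
      also have "\<dots> \<le> load ?Z p"
        unfolding load_def by (metis card_length length_map)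
      also have "\<dots> \<le> k * t" by (rule levels_invariants(3)[OF surjective_pairing])
      finally show ?thesis using r by linarith
    qed
    fix x assume x: "x \<in> X"
    have unassigned: "assignment N t l k S x = {#}" if "x \<notin> set S"
      using that facts(2)[OF S] by (simp add: assignment_def lookup_notin)
    show sub: "assignment N t l k S x \<subseteq># M x"
      using unassigned lk[of x] N(1)[OF x] by (cases "x \<in> set S") (auto simp: assignment_def)
    show "set_mset (assignment N t l k S x) \<subseteq> R"
      using set_mset_mono[OF sub] N[OF x] by (metis set_mset_mset subset_trans)
    show "assignment N t l k S x = {#}" if "x \<notin> set S" using that by (rule unassigned)
    show "l' \<le> real (size (assignment N t l k S x))" if "x \<in> set S"
      using lk[OF that] l by (auto simp: assignment_def)
    fix T assume xS: "x \<in> set S" and T: "set (S @ T) \<subseteq> X" "length (S @ T) \<le> 2 ^ k"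
    obtain ps where ps: "(x, ps) \<in> set ?Z" "lookup x ?Z = ps" using lk[OF xS] by blast
    have "(x, ps) \<in> set (snd (levels N t l k (S @ T)))"
      using levels_append[of N t l k S _ ?Z T] ps(1) by (metis snd_conv subsetD surjective_pairing)
    then show "assignment N t l k (S @ T) x = assignment N t l k S x"
      using lookup_eq[OF facts(1)[OF T]] ps(2) by (simp add: assignment_def)
  qed
qed

section \<open>Heavy edges and the condenser property\<close>

lemma finite_bitstrings [simp]: "finite (bitstrings n)"
  and card_bitstrings [simp]: "card (bitstrings n) = 2 ^ n"
  and bitstrings_nonempty [simp]: "bitstrings n \<noteq> {}"
proof -
  have *: "bitstrings n = {xs. set xs \<subseteq> UNIV \<and> length xs = n}" by (simp add: bitstrings_def)
  show "finite (bitstrings n)" unfolding * by (rule finite_lists_length_eq) simp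
  show "card (bitstrings n) = 2 ^ n" unfolding * by (subst card_lists_length_eq) simp_all
  then show "bitstrings n \<noteq> {}" by force
qed

text \<open>Turns output probabilities of the condenser on a uniform source into edge
  counts.\<close>

lemma pair_pmf_of_set:
  assumes "finite A" "A \<noteq> {}" "finite B" "B \<noteq> {}"
  shows "pair_pmf (pmf_of_set A) (pmf_of_set B) = pmf_of_set (A \<times> B)"
proof (rule pmf_eqI)
  fix z
  have "A \<times> B \<noteq> {}" "finite (A \<times> B)" using assms by simp_all
  from pmf_of_set[OF this]
  show "pmf (pair_pmf (pmf_of_set A) (pmf_of_set B)) z = pmf (pmf_of_set (A \<times> B)) z"
    using assms by (cases z) (simp add: pmf_pair card_cartesian_product indicator_def)
qed

text \<open>
  Let \<open>P\<close> be the output distribution on a uniform source over \<open>S\<close>, and \<open>Q\<close> the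
  nearby distribution of large min-entropy.  Every heavy point has at least twice its largest
  possible \<open>Q\<close>-probability under \<open>P\<close>, so \<open>Q(B) \<le> P(B) / 2\<close>, whence \<open>P(B) \<le> 2 \<epsilon>\<close>.
\<close>

lemma condenser_heavy_edges:
  assumes C: "condenser n d m (log 2 (card S)) \<epsilon> (log 2 (card S) + real d - real e) C"
    and S: "S \<subseteq> bitstrings n" "S \<noteq> {}"
    and heavy: "\<And>p. p \<in> B \<Longrightarrow> 2 * 2 ^ e \<le> card {(x, y) \<in> S \<times> bitstrings d. C x y = p}"
  shows "real (card {(x, y) \<in> S \<times> bitstrings d. C x y \<in> B}) \<le> 2 * \<epsilon> * card S * 2 ^ d"
proof -
  have fin: "finite S" using S finite_bitstrings finite_subset by blast
  have card_pos: "card S > 0" using fin S by (simp add: card_gt_0_iff)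
  define E where "E T = {(x, y) \<in> S \<times> bitstrings d. C x y \<in> T}" for T
  have finE: "finite (E T)" for T
    by (rule finite_subset[of _ "S \<times> bitstrings d"]) (auto simp: E_def fin)
  define P where "P = map_pmf (\<lambda>(x, y). C x y) (pair_pmf (pmf_of_set S) (pmf_of_set (bitstrings d)))"
  have P: "measure_pmf.prob P T = card (E T) / (card S * 2 ^ d)" for T
  proof -
    have "(S \<times> bitstrings d) \<inter> (\<lambda>(x, y). C x y) -` T = E T" by (auto simp: E_def)
    then show ?thesis using fin S
      by (simp add: P_def pair_pmf_of_set measure_pmf_of_set card_cartesian_product)
  qed
  have "has_min_entropy (log 2 (card S)) (pmf_of_set S)"
    using fin S card_pos by (auto simp: has_min_entropy_def powr_minus indicator_def divide_simps)
  then obtain Q where Q: "has_min_entropy (log 2 (card S) + real d - real e) Q" "eps_close \<epsilon> P Q"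
    using C S fin unfolding condenser_def P_def by (metis set_pmf_of_set)
  \<comment> \<open>The bound is the weight of \<open>2 ^ e\<close> among
    \<open>card S * 2 ^ d\<close> equally likely edges.\<close>
  have Qp: "pmf Q p \<le> 2 ^ e / (card S * 2 ^ d)" for p
  proof -
    have "2 powr - (log 2 (card S) + real d - real e) = 2 ^ e / (card S * 2 ^ d)"
      using card_pos by (simp add: powr_diff powr_add powr_minus powr_realpow field_simps)
    then show ?thesis using Q(1) by (simp add: has_min_entropy_def)
  qed
  \<comment> \<open>Heavy points have at least one incoming edge, so \<open>B\<close> is finite and
    its probability is a finite sum.\<close>
  have sub: "B \<subseteq> (\<lambda>(x, y). C x y) ` (S \<times> bitstrings d)"
  proof
    fix p assume "p \<in> B"
    then have "0 < card {(x, y) \<in> S \<times> bitstrings d. C x y = p}"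
      using heavy by (meson less_le_trans mult_pos_pos zero_less_numeral zero_less_power)
    then have "{(x, y) \<in> S \<times> bitstrings d. C x y = p} \<noteq> {}" by (metis card.empty less_irrefl)
    then show "p \<in> (\<lambda>(x, y). C x y) ` (S \<times> bitstrings d)" by auto
  qed
  then have finB: "finite B" by (rule finite_subset) (simp add: fin)
  have "card (E B) = (\<Sum>p\<in>B. card (E {p}))"
  proof -
    have "E B = (\<Union>p\<in>B. E {p})" by (auto simp: E_def)
    moreover have "card (\<Union>p\<in>B. E {p}) = (\<Sum>p\<in>B. card (E {p}))"
      by (intro card_UN_disjoint finB ballI impI finE) (auto simp: E_def)
    ultimately show ?thesis by simp
  qed
  also have "\<dots> \<ge> (\<Sum>p\<in>B. 2 * 2 ^ e)"
    using heavy by (intro sum_mono) (simp add: E_def)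
  finally have "real (card B * (2 * 2 ^ e)) \<le> card (E B)" by (subst of_nat_le_iff) simp
  then have PB: "card B * (2 ^ e / (card S * 2 ^ d)) \<le> measure_pmf.prob P B / 2"
    unfolding P using card_pos by (simp add: field_simps)
  have "measure_pmf.prob Q B = (\<Sum>p\<in>B. pmf Q p)" by (simp add: measure_measure_pmf_finite finB)
  also have "\<dots> \<le> card B * (2 ^ e / (card S * 2 ^ d))" by (rule sum_bounded_above) (rule Qp)
  finally have QB: "measure_pmf.prob Q B \<le> measure_pmf.prob P B / 2" using PB by linarith
  have "\<bar>measure_pmf.prob P B - measure_pmf.prob Q B\<bar> \<le> (SUP T. \<bar>measure_pmf.prob P T - measure_pmf.prob Q T\<bar>)"
  proof (rule cSUP_upper)
    \<comment> \<open>The supremum in \<open>eps_close\<close> dominates its value at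
      \<open>B\<close> only if the family is bounded; probabilities give the bound 1.\<close>
    show "bdd_above (range (\<lambda>T. \<bar>measure_pmf.prob P T - measure_pmf.prob Q T\<bar>))"
      by (rule bdd_aboveI2[of _ _ 1]) (smt (verit) measure_nonneg measure_pmf.prob_le_1)
  qed simp
  then have "measure_pmf.prob P B \<le> 2 * \<epsilon>" using Q(2) QB unfolding eps_close_def by linarith
  then show ?thesis using card_pos by (simp add: P E_def field_simps)
qed

text \<open>
  The threshold on the load is \<open>2 \<cdot> 2 ^ min e k\<close> and not \<open>2 \<cdot> 2 ^ e\<close> for the sake of
  computability.  This makes no difference: if \<open>k \<le> e\<close>, neither threshold is ever reached.
\<close>

lemma greedy_rejects_less_than_half:
  assumes C: "condenser_up_to n d m e k \<epsilon> C"
    and N: "\<And>x. x \<in> bitstrings n \<Longrightarrow> mset (N x) = nbrs d C x"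
    and t: "t = 2 * 2 ^ min e k" and l: "real l < (1 - 4 * \<epsilon>) * 2 ^ d + 1"
    and L: "set L \<subseteq> bitstrings n" "distinct L" "length L \<le> 2 ^ k" "L \<noteq> []"
    and g: "greedy N t l L = (A, F)"
  shows "2 * length F < length L"
proof (cases "F = []")
  case False
  define B where "B = {p. load A p \<ge> t}"
  have \<epsilon>: "\<epsilon> > 0" using C by (simp add: condenser_up_to_def)
  have cardL: "card (set L) = length L" using L by (simp add: distinct_card)
  have mset: "mset (map fst A @ F) = mset L" using greedy_mset[OF g] by simp
  then have dist: "distinct (map fst A @ F)" and set: "set (map fst A @ F) = set L"
    using L(2) by (metis mset_eq_imp_distinct_iff, metis mset_eq_setD)
  have setN: "set (N x) = C x ` bitstrings d" if "x \<in> bitstrings n" for x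
    using N[OF that] by (metis finite_bitstrings finite_set_mset_mset_set nbrs_def set_image_mset set_mset_mset)
  have heavy: "2 * 2 ^ e \<le> card {(x, y) \<in> set L \<times> bitstrings d. C x y = p}" if p: "p \<in> B" for p
  proof -
    \<comment> \<open>A load is at most the number of entries, hence at most \<open>2 ^ k\<close>. A
      reached threshold therefore forces \<open>e < k\<close>, and then it equals
      \<open>2 * 2 ^ e\<close>.\<close>
    have "load A p \<le> length A" by (simp add: load_def)
    also have "\<dots> \<le> length L" using mset by (metis length_append length_map le_add1 size_mset)
    finally have "2 * 2 ^ min e k \<le> (2::nat) ^ k" using p L(3) t by (simp add: B_def)
    then have "min e k < k" by (cases "min e k = k") auto
    then have "2 * 2 ^ e \<le> load A p" using p t by (simp add: B_def min_def split: if_splits)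
    also have "load A p = card (set (map fst (filter (\<lambda>(x, ps). p \<in> set ps) A)))"
      using dist by (subst distinct_card) (auto simp: load_def distinct_map_filter)
    \<comment> \<open>Each left node counted by the load has at least one edge into
      \<open>p\<close>; parallel edges can only increase the number of edges.\<close>
    also have "\<dots> \<le> card (fst ` {(x, y) \<in> set L \<times> bitstrings d. C x y = p})"
    proof (rule card_mono)
      show "finite (fst ` {(x, y) \<in> set L \<times> bitstrings d. C x y = p})"
        by (rule finite_subset[of _ "set L"]) auto
      show "set (map fst (filter (\<lambda>(x, ps). p \<in> set ps) A)) \<subseteq> fst ` {(x, y) \<in> set L \<times> bitstrings d. C x y = p}"
      proof
        fix x assume "x \<in> set (map fst (filter (\<lambda>(x, ps). p \<in> set ps) A))"
        then obtain ps where ps: "(x, ps) \<in> set A" "p \<in> set ps" by auto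
        have x: "x \<in> set L" using ps(1) set by force
        have "p \<in> set (N x)" using greedy_entries[OF g ps(1)] ps(2)
          by (metis mset_subset_eqD set_mset_mset)
        then obtain y where "y \<in> bitstrings d" "C x y = p" using setN[OF subsetD[OF L(1) x]] by auto
        with x show "x \<in> fst ` {(x, y) \<in> set L \<times> bitstrings d. C x y = p}" by force
      qed
    qed
    also have "\<dots> \<le> card {(x, y) \<in> set L \<times> bitstrings d. C x y = p}"
      by (rule card_image_le, rule finite_subset[of _ "set L \<times> bitstrings d"]) auto
    finally show ?thesis .
  qed
  \<comment> \<open>The source is uniform on the current list, whose size need not be a power of
    two. This is why non-integer exponents \<open>k\<close> with natural \<open>2 powr k\<close> are
    required.\<close>
  have "condenser n d m (log 2 (card (set L))) \<epsilon> (log 2 (card (set L)) + real d - real e) C"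
  proof -
    have pos: "length L > 0" using L by simp
    have "log 2 (length L) \<le> log 2 (2 ^ k)" using L(3) pos
      by (subst log_le_cancel_iff) (simp_all add: of_nat_le_numeral_power_cancel_iff)
    then have "log 2 (length L) \<le> real k" by (simp add: log_nat_power)
    moreover have "2 powr log 2 (length L) \<in> \<nat>" using pos by simp
    ultimately show ?thesis using C unfolding cardL condenser_up_to_def by blast
  qed
  from condenser_heavy_edges[OF this L(1) _ heavy]
  have "real (card {(x, y) \<in> set L \<times> bitstrings d. C x y \<in> B}) \<le> 2 * \<epsilon> * length L * 2 ^ d"
    using L(4) cardL by simp
  moreover have "length F * (4 * \<epsilon> * 2 ^ d) < card {(x, y) \<in> set L \<times> bitstrings d. C x y \<in> B}"
  proof -
    have many: "4 * \<epsilon> * 2 ^ d < card {y \<in> bitstrings d. C x y \<in> B}" if x: "x \<in> set F" for x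
    proof -
      have xn: "x \<in> bitstrings n" using x set L(1) by auto
      have "length (filter (\<lambda>p. load A p < t) (N x)) = size (filter_mset (\<lambda>p. load A p < t) (nbrs d C x))"
        using N[OF xn] by (metis mset_filter size_mset)
      also have "\<dots> = card {y \<in> bitstrings d. load A (C x y) < t}"
        by (simp add: nbrs_def filter_mset_image_mset)
      also have "{y \<in> bitstrings d. load A (C x y) < t} = bitstrings d - {y \<in> bitstrings d. C x y \<in> B}"
        by (auto simp: B_def)
      also have "card \<dots> = 2 ^ d - card {y \<in> bitstrings d. C x y \<in> B}"
        by (subst card_Diff_subset) auto
      finally have "2 ^ d - card {y \<in> bitstrings d. C x y \<in> B} < l"
        using greedy_rejected[OF g x] by simp
      \<comment> \<open>A rejected node has at most \<open>l - 1\<close> free edges, and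
        \<open>l - 1\<close> is below \<open>(1 - 4 * \<epsilon>) * 2 ^ d\<close>. This off-by-one
        makes the bound on its heavy edges strict.\<close>
      then have "2 ^ d + 1 \<le> l + card {y \<in> bitstrings d. C x y \<in> B}" by linarith
      then have "real (2 ^ d + 1) \<le> real (l + card {y \<in> bitstrings d. C x y \<in> B})"
        by (simp only: of_nat_le_iff)
      then show ?thesis using l by (simp add: algebra_simps)
    qed
    have "length F * (4 * \<epsilon> * 2 ^ d) = (\<Sum>x\<in>set F. 4 * \<epsilon> * 2 ^ d)"
      using dist by (simp add: distinct_card)
    also have "\<dots> < (\<Sum>x\<in>set F. real (card {y \<in> bitstrings d. C x y \<in> B}))"
      using many False by (intro sum_strict_mono) auto
    also have "\<dots> = card (SIGMA x:set F. {y \<in> bitstrings d. C x y \<in> B})" by simp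
    also have "\<dots> \<le> card {(x, y) \<in> set L \<times> bitstrings d. C x y \<in> B}"
    proof -
      have "finite {(x, y) \<in> set L \<times> bitstrings d. C x y \<in> B}"
        by (rule finite_subset[of _ "set L \<times> bitstrings d"]) auto
      then show ?thesis using set by (intro of_nat_mono card_mono) auto
    qed
    finally show ?thesis .
  qed
  ultimately have "real (length F) * (4 * \<epsilon> * 2 ^ d) < 2 * \<epsilon> * length L * 2 ^ d" by linarith
  then have "2 * \<epsilon> * 2 ^ d * (2 * real (length F)) < 2 * \<epsilon> * 2 ^ d * length L" by (simp add: algebra_simps)
  then have "2 * real (length F) < length L"
    using \<epsilon> by (simp add: mult_less_cancel_left_pos)
  then show ?thesis by linarith
qed (use L in simp)

text \<open>The smaller threshold keeps the total load within \<open>2 * k * 2 ^ e\<close>, and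
  since sizes are natural numbers, rounding the required size up loses nothing.\<close>

lemma condenser_online_assignment:
  assumes C: "condenser_up_to n d m e k \<epsilon> C"
    and N: "\<And>x. x \<in> bitstrings n \<Longrightarrow> mset (N x) = nbrs d C x"
  shows "online_assignment (bitstrings n) (bitstrings m) (nbrs d C) ((1 - 4 * \<epsilon>) * 2 ^ d)
    (2 * real k * 2 ^ e) (2 ^ k) (assignment N (2 * 2 ^ min e k) (nat \<lceil>(1 - 4 * \<epsilon>) * 2 ^ d\<rceil>) k)"
proof (rule online_assignment_assignment)
  show "k > 0" using C by (simp add: condenser_up_to_def)
  show "mset (N x) = nbrs d C x" if "x \<in> bitstrings n" for x using N that .
  show "set (N x) \<subseteq> bitstrings m" if "x \<in> bitstrings n" for x
  proof -
    have "set (N x) = C x ` bitstrings d"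
      using N[OF that] by (metis finite_bitstrings finite_set_mset_mset_set nbrs_def set_image_mset set_mset_mset)
    then show ?thesis using C that by (auto simp: condenser_up_to_def maps_bitstrings_def)
  qed
  show "(1 - 4 * \<epsilon>) * 2 ^ d \<le> real (nat \<lceil>(1 - 4 * \<epsilon>) * 2 ^ d\<rceil>)" by linarith
  have "(2::real) ^ min e k \<le> 2 ^ e" by (rule power_increasing) simp_all
  then show "real (k * (2 * 2 ^ min e k)) \<le> 2 * real k * 2 ^ e"
    by (simp add: mult.commute mult_left_mono)
  show "2 * length F < length L"
    if "set L \<subseteq> bitstrings n" "distinct L" "length L \<le> 2 ^ k" "L \<noteq> []"
      "greedy N (2 * 2 ^ min e k) (nat \<lceil>(1 - 4 * \<epsilon>) * 2 ^ d\<rceil>) L = (A, F)" for L A F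
  \<comment> \<open>For \<open>\<epsilon> \<ge> 1/4\<close> the required size is truncated to 0. The
    bound on \<open>l\<close> needed for the halving argument may then fail, but no node is ever
    rejected.\<close>
  proof (cases "nat \<lceil>(1 - 4 * \<epsilon>) * 2 ^ d\<rceil> = 0")
    case True
    have "F = []"
    proof (rule ccontr)
      assume "F \<noteq> []"
      then obtain x where "x \<in> set F" by fastforce
      from greedy_rejected[OF that(5) this] True show False by simp
    qed
    then show ?thesis using that by simp
  next
    case False
    then have "real (nat \<lceil>(1 - 4 * \<epsilon>) * 2 ^ d\<rceil>) < (1 - 4 * \<epsilon>) * 2 ^ d + 1" by linarith
    from greedy_rejects_less_than_half[OF C N refl this that] show ?thesis .
  qed
qed

section \<open>Looping programs and their running times\<close>

abbreviation seq_infix (infixr ";;" 65) where "p ;; q \<equiv> Seq p q"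

section \<open>Cost rules for the program constructors\<close>

text \<open>Timing proofs begin with this rule: output and cost are first found by unification and
  only then compared with the intended ones.\<close>

lemma outputs_within_mono:
  "outputs_within p v w T \<Longrightarrow> w = w' \<Longrightarrow> T \<le> T' \<Longrightarrow> outputs_within p v w' T'"
  unfolding outputs_within_def using order_trans by blast

lemma outputs_within_Pair:
  "outputs_within p v a S \<Longrightarrow> outputs_within q v b T \<Longrightarrow> outputs_within (Pair p q) v (Node a b) (S + T + 1)"
  unfolding outputs_within_def by (meson add_mono order_refl runs.Pair)

lemma outputs_within_Seq:
  "outputs_within p u v S \<Longrightarrow> outputs_within q v w T \<Longrightarrow> outputs_within (p ;; q) u w (S + T + 1)"
  unfolding outputs_within_def by (meson add_mono order_refl runs.Seq)

text \<open>Charging for both branches allows the rule to be applied before it is known which one is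
  taken.\<close>

lemma outputs_within_Cond:
  assumes "outputs_within b v u R"
    and "u \<noteq> Leaf \<Longrightarrow> outputs_within p v w S" "u = Leaf \<Longrightarrow> outputs_within q v w' T"
  shows "outputs_within (Cond b p q) v (if u = Leaf then w' else w) (R + (S + T) + 1)"
proof -
  obtain r where r: "r \<le> R" "runs b v u r" using assms(1) by (auto simp: outputs_within_def)
  show ?thesis
  proof (cases u)
    case Leaf
    then obtain t where t: "t \<le> T" "runs q v w' t" using assms(3) by (auto simp: outputs_within_def)
    from runs.Cond_false[OF r(2)[unfolded Leaf] t(2)] t(1) show ?thesis using r Leaf unfolding outputs_within_def
      by (intro exI[of _ "r + t + 1"]) simp
  next
    case (Node c c')
    then obtain s where s: "s \<le> S" "runs p v w s" using assms(2) by (auto simp: outputs_within_def)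
    from runs.Cond_true[OF r(2)[unfolded Node] s(2)] s(1) show ?thesis
      using r Node unfolding outputs_within_def by (intro exI[of _ "r + s + 1"]) simp
  qed
qed

lemma enc_nat_0 [simp]: "enc_nat 0 = Leaf"
  and enc_nat_Suc [simp]: "enc_nat (Suc k) = Node Leaf (enc_nat k)"
  by (simp_all add: enc_nat_def)

lemma enc_list_eq_Leaf_iff [simp]: "enc_list f xs = Leaf \<longleftrightarrow> xs = []"
  and enc_bit_eq_Leaf_iff [simp]: "enc_bit c = Leaf \<longleftrightarrow> \<not> c"
  and enc_nat_eq_Leaf_iff [simp]: "enc_nat k = Leaf \<longleftrightarrow> k = 0"
  proof -
  show "enc_list f xs = Leaf \<longleftrightarrow> xs = []" by (cases xs) simp_all
  show "enc_bit c = Leaf \<longleftrightarrow> \<not> c" by (cases c) simp_all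
  show "enc_nat k = Leaf \<longleftrightarrow> k = 0" by (cases k) simp_all
qed

text \<open>On a unary numeral \<open>Snd\<close> is the truncated predecessor, because
  \<open>Snd\<close> maps \<open>Leaf\<close> to \<open>Leaf\<close>.\<close>

lemma outputs_within_basic:
  "outputs_within Id v v 1" "outputs_within (Quote c) v c 1"
  "outputs_within Fst (Node a b) a 1" "outputs_within Snd (Node a b) b 1"
  "outputs_within Snd (enc_nat k) (enc_nat (k - 1)) 1"
proof -
  show "outputs_within Snd (enc_nat k) (enc_nat (k - 1)) 1"
    unfolding outputs_within_def using runs.Snd_Leaf runs.Snd_Node by (cases k) fastforce+
qed (use runs.Id runs.Quote runs.Fst_Node runs.Snd_Node in \<open>auto simp: outputs_within_def\<close>)

lemmas outputs_within_rules =
  outputs_within_basic outputs_within_Pair outputs_within_Seq outputs_within_Cond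

text \<open>
  A loop over a list: its input is \<open>(list, (accumulator, environment))\<close>, and the body maps
  \<open>(element, (accumulator, environment))\<close> to the next accumulator.
\<close>

definition foldp :: "prog \<Rightarrow> prog" where
  "foldp B = While Fst (Pair (Fst ;; Snd) (Pair (Pair (Fst ;; Fst) Snd ;; B) (Snd ;; Snd))) ;; Snd ;; Fst"

text \<open>\<open>st j\<close> is the accumulator after \<open>j\<close> elements. An iteration
  costs 16 beyond \<open>B\<close>: 14 for unpacking and rebuilding the state, 2 for the test and
  the loop itself. The final 6 pays for the last test and for extracting the result.\<close>

lemma outputs_within_foldp:
  assumes step: "\<And>j. j < length xs \<Longrightarrow>
      outputs_within B (Node (enc (xs ! j)) (Node (st j) env)) (st (Suc j)) T"
    and M: "length xs \<le> M" and st: "acc = st 0" "w = st (length xs)"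
  shows "outputs_within (foldp B) (Node (enc_list enc xs) (Node acc env)) w (M * (T + 16) + 6)"
proof -
  let ?body = "Pair (Fst ;; Snd) (Pair (Pair (Fst ;; Fst) Snd ;; B) (Snd ;; Snd))"
  have "outputs_within (While Fst ?body) (Node (enc_list enc (drop j xs)) (Node (st j) env))
      (Node Leaf (Node (st (length xs)) env)) ((length xs - j) * (T + 16) + 2)" if "j \<le> length xs" for j
    using that
  \<comment> \<open>The induction runs backwards from the exhausted list, so each step puts one
    iteration in front of a run already timed.\<close>
  proof (induction rule: inc_induct)
    case base
    have "runs (While Fst ?body) (Node Leaf (Node (st (length xs)) env)) (Node Leaf (Node (st (length xs)) env)) (1 + 1)"
      by (intro runs.intros)
    then show ?case by (auto simp: outputs_within_def)
  next
    case (step j)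
    have dr: "drop j xs = xs ! j # drop (Suc j) xs" using step.hyps by (simp add: Cons_nth_drop_Suc)
    have "outputs_within ?body (Node (enc_list enc (drop j xs)) (Node (st j) env))
      (Node (enc_list enc (drop (Suc j) xs)) (Node (st (Suc j)) env)) (T + 14)"
      unfolding dr enc_list.simps
      by (rule outputs_within_mono, (rule assms(1)[OF step.hyps(2)] outputs_within_rules)+) simp_all
    then obtain s where s: "s \<le> T + 14" "runs ?body (Node (enc_list enc (drop j xs)) (Node (st j) env))
      (Node (enc_list enc (drop (Suc j) xs)) (Node (st (Suc j)) env)) s"
      by (auto simp: outputs_within_def)
    from step.IH obtain t where t: "t \<le> (length xs - Suc j) * (T + 16) + 2"
      "runs (While Fst ?body) (Node (enc_list enc (drop (Suc j) xs)) (Node (st (Suc j)) env))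
        (Node Leaf (Node (st (length xs)) env)) t"
      by (auto simp: outputs_within_def)
    have "runs Fst (Node (enc_list enc (drop j xs)) (Node (st j) env))
      (Node (enc (xs ! j)) (enc_list enc (drop (Suc j) xs))) 1"
      unfolding dr enc_list.simps by (rule runs.Fst_Node)
    from runs.While_true[OF this s(2) t(2)]
    have "runs (While Fst ?body) (Node (enc_list enc (drop j xs)) (Node (st j) env))
      (Node Leaf (Node (st (length xs)) env)) (1 + s + t + 1)" .
    moreover have "length xs - j = Suc (length xs - Suc j)" using step.hyps by simp
    then have "1 + s + t + 1 \<le> (length xs - j) * (T + 16) + 2"
      using s(1) t(1) by simp
    ultimately show ?case unfolding outputs_within_def by blast
  qed
  from this[of 0]
  have "outputs_within (While Fst ?body) (Node (enc_list enc xs) (Node acc env))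
      (Node Leaf (Node w env)) (length xs * (T + 16) + 2)" by (simp add: st)
  note while = outputs_within_Seq[OF this outputs_within_Seq[OF outputs_within_basic(4,3)]]
  have "length xs * (T + 16) \<le> M * (T + 16)" using M by (rule mult_right_mono) simp
  then show ?thesis
    unfolding foldp_def by (intro outputs_within_mono[OF while refl]) linarith
qed

lemma outputs_within_foldp_nat:
  assumes "\<And>j. j < k \<Longrightarrow> outputs_within B (Node Leaf (Node (st j) env)) (st (Suc j)) T"
    and "k \<le> M" "acc = st 0" "w = st k"
  shows "outputs_within (foldp B) (Node (enc_nat k) (Node acc env)) w (M * (T + 16) + 6)"
  unfolding enc_nat_def
  by (rule outputs_within_foldp[where st = st]) (use assms in simp_all)

section \<open>Equality and membership tests\<close>

text \<open>Strings have to be compared bit by bit. The accumulator holds the unread bits of the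
  second string and the verdict so far.\<close>

definition eq_body :: prog where
  "eq_body = Pair (Snd ;; Fst ;; Fst ;; Snd)
     (Cond Fst
       (Cond (Snd ;; Fst ;; Fst ;; Fst) (Snd ;; Fst ;; Snd) (Quote Leaf))
       (Cond (Snd ;; Fst ;; Fst ;; Fst) (Quote Leaf) (Snd ;; Fst ;; Snd)))"

definition eq_prog :: prog where
  "eq_prog = Pair Fst (Pair (Pair Snd (Quote (enc_bit True))) (Quote Leaf)) ;; foldp eq_body ;; Snd"

text \<open>The constants in this and the later time bounds are generous; what matters is that the
  bounds stay polynomial.\<close>

definition eq_time :: "nat \<Rightarrow> nat" where "eq_time M = 100 * M + 100"

lemma outputs_within_eq_prog:
  assumes len: "length p = length q" "length p \<le> M"
  shows "outputs_within eq_prog (Node (enc_bits p) (enc_bits q)) (enc_bit (p = q)) (eq_time M)"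
proof -
  define st where "st j = Node (enc_bits (drop j q)) (enc_bit (take j p = take j q))" for j
  have step: "outputs_within eq_body (Node (enc_bit (p ! j)) (Node (st j) Leaf)) (st (Suc j)) 60"
    if j: "j < length p" for j
  proof -
    have dr: "drop j q = q ! j # drop (Suc j) q" using j len by (simp add: Cons_nth_drop_Suc)
    show ?thesis unfolding st_def dr enc_list.simps eq_body_def
      by (rule outputs_within_mono, (rule outputs_within_rules)+)
        (use j len in \<open>auto simp: take_Suc_conv_app_nth\<close>)
  qed
  have fold: "outputs_within (foldp eq_body) (Node (enc_bits p) (Node (Node (enc_bits q) (enc_bit True)) Leaf))
      (Node Leaf (enc_bit (p = q))) (M * (60 + 16) + 6)"
    by (rule outputs_within_foldp[where st = st, OF step]) (use len in \<open>simp_all add: st_def\<close>)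
  show ?thesis unfolding eq_prog_def
    by (rule outputs_within_mono, (rule fold outputs_within_rules)+) (simp_all add: eq_time_def)
qed

definition mem_body :: prog where
  "mem_body = Cond (Pair (Snd ;; Snd) Fst ;; eq_prog) (Quote (enc_bit True)) (Snd ;; Fst)"

definition mem_prog :: prog where
  "mem_prog = Pair Snd (Pair (Quote (enc_bit False)) Fst) ;; foldp mem_body"

definition mem_time :: "nat \<Rightarrow> nat" where "mem_time M = M * (eq_time M + 100) + 100"

lemma outputs_within_mem_prog:
  assumes "\<And>q. q \<in> set ps \<Longrightarrow> length q = length p" "length p \<le> M" "length ps \<le> M"
  shows "outputs_within mem_prog (Node (enc_bits p) (enc_list enc_bits ps)) (enc_bit (p \<in> set ps)) (mem_time M)"
proof -
  define st where "st j = enc_bit (p \<in> set (take j ps))" for j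
  have step: "outputs_within mem_body (Node (enc_bits (ps ! j)) (Node (st j) (enc_bits p))) (st (Suc j))
      (eq_time M + 60)" if j: "j < length ps" for j
  proof -
    have eq: "outputs_within eq_prog (Node (enc_bits p) (enc_bits (ps ! j))) (enc_bit (p = ps ! j)) (eq_time M)"
      using assms(1)[of "ps ! j"] j assms(2) by (intro outputs_within_eq_prog) simp_all
    show ?thesis unfolding st_def mem_body_def
      by (rule outputs_within_mono, (rule eq outputs_within_rules)+)
        (use j in \<open>auto simp: take_Suc_conv_app_nth\<close>)
  qed
  have fold: "outputs_within (foldp mem_body) (Node (enc_list enc_bits ps) (Node (enc_bit False) (enc_bits p)))
      (enc_bit (p \<in> set ps)) (M * (eq_time M + 60 + 16) + 6)"
    by (rule outputs_within_foldp[where st = st, OF step]) (use assms in \<open>simp_all add: st_def\<close>)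
  show ?thesis unfolding mem_prog_def
    by (rule outputs_within_mono, (rule fold outputs_within_rules)+)
      (simp_all add: mem_time_def algebra_simps)
qed

section \<open>Encodings and elementary list programs\<close>

fun enc_entry :: "bool list \<times> bool list list \<Rightarrow> tree" where
  "enc_entry (x, ps) = Node (enc_bits x) (enc_list enc_bits ps)"

fun enc_greedy :: "(bool list \<times> bool list list) list \<times> bool list list \<Rightarrow> tree" where
  "enc_greedy (A, F) = Node (enc_list enc_entry A) (enc_list enc_bits F)"

fun enc_levels :: "bool list list \<times> (bool list \<times> bool list list) list \<Rightarrow> tree" where
  "enc_levels (L, Z) = Node (enc_list enc_bits L) (enc_list enc_entry Z)"

definition revapp_body :: prog where "revapp_body = Pair Fst (Snd ;; Fst)"

definition revapp_prog :: prog where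
  "revapp_prog = Pair Fst (Pair Snd (Quote Leaf)) ;; foldp revapp_body"

definition revapp_time :: "nat \<Rightarrow> nat" where "revapp_time M = M * 50 + 50"

lemma outputs_within_revapp_prog:
  assumes "length A \<le> M"
  shows "outputs_within revapp_prog (Node (enc_list enc A) (enc_list enc Z)) (enc_list enc (rev A @ Z)) (revapp_time M)"
proof -
  define st where "st j = enc_list enc (rev (take j A) @ Z)" for j
  have step: "outputs_within revapp_body (Node (enc (A ! j)) (Node (st j) Leaf)) (st (Suc j)) 20"
    if "j < length A" for j
    unfolding revapp_body_def
    by (rule outputs_within_mono, (rule outputs_within_rules)+)
      (use that in \<open>simp_all add: st_def take_Suc_conv_app_nth\<close>)
  have fold: "outputs_within (foldp revapp_body) (Node (enc_list enc A) (Node (enc_list enc Z) Leaf))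
      (enc_list enc (rev A @ Z)) (M * (20 + 16) + 6)"
    by (rule outputs_within_foldp[where st = st, OF step]) (use assms in \<open>simp_all add: st_def\<close>)
  show ?thesis unfolding revapp_prog_def
    by (rule outputs_within_mono, (rule fold outputs_within_rules)+) (simp_all add: revapp_time_def)
qed

definition dedup_body :: prog where
  "dedup_body = Cond (Pair Fst (Snd ;; Fst) ;; mem_prog) (Snd ;; Fst) (Pair Fst (Snd ;; Fst))"

definition dedup_prog :: prog where
  "dedup_prog = Pair Id (Pair (Quote (enc_bits [])) (Quote Leaf)) ;; foldp dedup_body"

definition dedup_time :: "nat \<Rightarrow> nat" where "dedup_time M = M * (mem_time M + 100) + 100"

lemma outputs_within_dedup_prog:
  assumes S: "set S \<subseteq> bitstrings n" and M: "length S \<le> M" "n \<le> M"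
  shows "outputs_within dedup_prog (enc_list enc_bits S) (enc_list enc_bits (fold List.insert S [])) (dedup_time M)"
proof -
  define D where "D j = fold List.insert (take j S) []" for j
  define st where "st j = enc_list enc_bits (D j)" for j
  have step: "outputs_within dedup_body (Node (enc_bits (S ! j)) (Node (st j) Leaf)) (st (Suc j)) (mem_time M + 60)"
    if j: "j < length S" for j
  proof -
    have D: "set (D j) \<subseteq> set S" "length (D j) \<le> M"
      using length_fold_insert[of "take j S" "[]"] j M(1) by (auto simp: D_def set_fold_insert dest: in_set_takeD)
    have mem: "outputs_within mem_prog (Node (enc_bits (S ! j)) (enc_list enc_bits (D j)))
        (enc_bit (S ! j \<in> set (D j))) (mem_time M)"
      using S D nth_mem[OF j] M by (intro outputs_within_mem_prog) (auto simp: bitstrings_def)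
    have "D (Suc j) = List.insert (S ! j) (D j)"
      using j by (simp add: D_def take_Suc_conv_app_nth)
    then show ?thesis unfolding st_def dedup_body_def
      by - (rule outputs_within_mono, (rule mem outputs_within_rules)+, simp_all add: List.insert_def)
  qed
  have fold: "outputs_within (foldp dedup_body) (Node (enc_list enc_bits S) (Node (enc_bits []) Leaf))
      (enc_list enc_bits (fold List.insert S [])) (M * (mem_time M + 60 + 16) + 6)"
    by (rule outputs_within_foldp[where st = st, OF step]) (use M in \<open>simp_all add: st_def D_def\<close>)
  show ?thesis unfolding dedup_prog_def
    by (rule outputs_within_mono, (rule fold outputs_within_rules)+) (simp_all add: dedup_time_def algebra_simps)
qed

definition lookup_body :: prog where
  "lookup_body = Cond (Pair (Fst ;; Fst) (Snd ;; Snd) ;; eq_prog) (Fst ;; Snd) (Snd ;; Fst)"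

definition lookup_prog :: prog where
  "lookup_prog = Pair Snd (Pair (Quote (enc_bits [])) Fst) ;; foldp lookup_body"

definition lookup_time :: "nat \<Rightarrow> nat" where "lookup_time M = M * (eq_time M + 100) + 100"

lemma outputs_within_lookup_prog:
  assumes Z: "\<And>z ps. (z, ps) \<in> set Z \<Longrightarrow> length z = length x" and M: "length Z \<le> M" "length x \<le> M"
  shows "outputs_within lookup_prog (Node (enc_bits x) (enc_list enc_entry Z))
    (enc_list enc_bits (lookup x Z)) (lookup_time M)"
proof -
  define st where "st j = enc_list enc_bits (lookup x (take j Z))" for j
  have step: "outputs_within lookup_body (Node (enc_entry (Z ! j)) (Node (st j) (enc_bits x))) (st (Suc j)) (eq_time M + 60)"
    if j: "j < length Z" for j
  proof -
    obtain z ps where zp: "Z ! j = (z, ps)" by fastforce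
    have eq: "outputs_within eq_prog (Node (enc_bits z) (enc_bits x)) (enc_bit (z = x)) (eq_time M)"
      using Z[of z ps] nth_mem[OF j] zp M(2) by (intro outputs_within_eq_prog) auto
    show ?thesis unfolding st_def lookup_body_def zp enc_entry.simps
      by (rule outputs_within_mono, (rule eq outputs_within_rules)+)
        (use j in \<open>auto simp: take_Suc_conv_app_nth lookup_append zp\<close>)
  qed
  have fold: "outputs_within (foldp lookup_body) (Node (enc_list enc_entry Z) (Node (enc_bits []) (enc_bits x)))
      (enc_list enc_bits (lookup x Z)) (M * (eq_time M + 60 + 16) + 6)"
    by (rule outputs_within_foldp[where st = st, OF step]) (use M in \<open>simp_all add: st_def lookup_def\<close>)
  show ?thesis unfolding lookup_prog_def
    by (rule outputs_within_mono, (rule fold outputs_within_rules)+) (simp_all add: lookup_time_def algebra_simps)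
qed

section \<open>Enumeration of the seeds\<close>

text \<open>The order is arbitrary. The form with \<open>fold\<close> matches a loop that prepends
  two strings per element, so \<open>d\<close> passes over lists shorter than \<open>2 ^ d\<close>
  suffice.\<close>

primrec bits_list :: "nat \<Rightarrow> bool list list" where
  "bits_list 0 = [[]]"
| "bits_list (Suc d) = fold (\<lambda>y acc. (False # y) # (True # y) # acc) (bits_list d) []"

lemma fold_extend_bits:
  "mset (fold (\<lambda>y acc. (False # y) # (True # y) # acc) L K) =
    image_mset (Cons False) (mset L) + image_mset (Cons True) (mset L) + mset K"
  by (induction L arbitrary: K) simp_all

lemma mset_bits_list: "mset (bits_list d) = mset_set (bitstrings d)"
proof (induction d)
  case 0
  have "bitstrings 0 = {[]}" by (auto simp: bitstrings_def)
  then show ?case by simp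
next
  case (Suc d)
  have "bitstrings (Suc d) = Cons False ` bitstrings d \<union> Cons True ` bitstrings d"
    by (auto simp: bitstrings_def length_Suc_conv image_iff)
  moreover have "Cons False ` bitstrings d \<inter> Cons True ` bitstrings d = {}" by auto
  ultimately show ?case
    using Suc by (simp add: fold_extend_bits mset_set_Union image_mset_mset_set)
qed

lemma length_bits_list: "length (bits_list d) = 2 ^ d"
  and set_bits_list: "set (bits_list d) = bitstrings d"
  using arg_cong[OF mset_bits_list, of size d] arg_cong[OF mset_bits_list, of set_mset d] by simp_all

definition extend_body :: prog where
  "extend_body = Pair (Pair (Quote (enc_bit False)) Fst) (Pair (Pair (Quote (enc_bit True)) Fst) (Snd ;; Fst))"

definition bits_body :: prog where
  "bits_body = Pair (Snd ;; Fst) (Pair (Quote (enc_bits [])) (Quote Leaf)) ;; foldp extend_body"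

definition bits_prog :: prog where
  "bits_prog = Pair Id (Pair (Quote (enc_list enc_bits [[]])) (Quote Leaf)) ;; foldp bits_body"

definition bits_time :: "nat \<Rightarrow> nat" where "bits_time M = M * (M * 100 + 100) + 100"

lemma outputs_within_bits_prog:
  assumes M: "2 ^ d \<le> M"
  shows "outputs_within bits_prog (enc_nat d) (enc_list enc_bits (bits_list d)) (bits_time M)"
proof -
  have step: "outputs_within bits_body (Node Leaf (Node (enc_list enc_bits (bits_list j)) Leaf))
      (enc_list enc_bits (bits_list (Suc j))) (M * (40 + 16) + 60)" if j: "j < d" for j
  proof -
    let ?E = "\<lambda>L. fold (\<lambda>y acc. (False # y) # (True # y) # acc) L []"
    have "(2::nat) ^ j \<le> 2 ^ d" using j by (intro power_increasing) simp_all
    then have "2 ^ j \<le> M" using M by (rule order_trans)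
    then have len: "length (bits_list j) \<le> M" by (simp add: length_bits_list)
    define st where "st i = enc_list enc_bits (?E (take i (bits_list j)))" for i
    have step: "outputs_within extend_body (Node (enc_bits (bits_list j ! i)) (Node (st i) Leaf)) (st (Suc i)) 40"
      if "i < length (bits_list j)" for i
      unfolding extend_body_def
      by (rule outputs_within_mono, (rule outputs_within_rules)+)
        (use that in \<open>simp_all add: st_def take_Suc_conv_app_nth\<close>)
    have fold: "outputs_within (foldp extend_body) (Node (enc_list enc_bits (bits_list j)) (Node (enc_bits []) Leaf))
        (enc_list enc_bits (bits_list (Suc j))) (M * (40 + 16) + 6)"
      by (rule outputs_within_foldp[where st = st, OF step]) (use len in \<open>simp_all add: st_def\<close>)
    show ?thesis unfolding bits_body_def
      by (rule outputs_within_mono, (rule fold outputs_within_rules)+) simp_all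
  qed
  have "d \<le> M" using M less_exp[of d] by linarith
  then have fold: "outputs_within (foldp bits_body) (Node (enc_nat d) (Node (enc_list enc_bits [[]]) Leaf))
      (enc_list enc_bits (bits_list d)) (M * (M * (40 + 16) + 60 + 16) + 6)"
    by (intro outputs_within_foldp_nat[where st = "\<lambda>j. enc_list enc_bits (bits_list j)", OF step]) simp_all
  show ?thesis unfolding bits_prog_def
    by (rule outputs_within_mono, (rule fold outputs_within_rules)+) (simp_all add: bits_time_def algebra_simps)
qed

section \<open>Thresholds and comparisons on unary numerals\<close>

text \<open>Looping over a numeral with the same numeral as initial accumulator doubles it.\<close>

definition double_body :: prog where "double_body = Pair (Quote Leaf) (Snd ;; Fst)"

text \<open>The loop runs over \<open>k\<close>, because \<open>e\<close> is not bounded by the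
  quantities allowed in the running time. Each pass decrements \<open>e\<close> and doubles the
  result only while \<open>e\<close> is nonzero, which yields the exponent
  \<open>min e k\<close>.\<close>

definition threshold_body :: prog where
  "threshold_body = Cond (Snd ;; Fst ;; Fst)
     (Pair (Snd ;; Fst ;; Fst ;; Snd)
       (Snd ;; Fst ;; Snd ;; Pair Id (Pair Id (Quote Leaf)) ;; foldp double_body))
     (Snd ;; Fst)"

definition threshold_prog :: prog where
  "threshold_prog = Pair Fst (Pair (Pair Snd (Quote (enc_nat 2))) (Quote Leaf)) ;; foldp threshold_body ;; Snd"

definition threshold_time :: "nat \<Rightarrow> nat" where "threshold_time M = M * (M * 100 + 100) + 100"

lemma outputs_within_threshold_prog:
  assumes M: "2 * 2 ^ k \<le> M"
  shows "outputs_within threshold_prog (Node (enc_nat k) (enc_nat e)) (enc_nat (2 * 2 ^ min e k)) (threshold_time M)"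
proof -
  define st where "st j = Node (enc_nat (e - j)) (enc_nat (2 * 2 ^ min e j))" for j
  have step: "outputs_within threshold_body (Node Leaf (Node (st j) Leaf)) (st (Suc j)) (M * (20 + 16) + 80)"
    if j: "j < k" for j
  proof -
    have dstep: "outputs_within double_body (Node Leaf (Node (enc_nat (N + i)) Leaf)) (enc_nat (N + Suc i)) 20" for N i
      unfolding double_body_def
      by (rule outputs_within_mono, (rule outputs_within_rules)+) simp_all
    have "(2::nat) ^ min e j \<le> 2 ^ k" using j by (intro power_increasing) simp_all
    then have "2 * 2 ^ min e j \<le> M" using M by linarith
    then have double: "outputs_within (foldp double_body)
        (Node (enc_nat (2 * 2 ^ min e j)) (Node (enc_nat (2 * 2 ^ min e j)) Leaf))
        (enc_nat (2 * 2 ^ min e j + 2 * 2 ^ min e j)) (M * (20 + 16) + 6)"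
      by (intro outputs_within_foldp_nat[where st = "\<lambda>i. enc_nat (2 * 2 ^ min e j + i)", OF dstep]) simp_all
    show ?thesis unfolding st_def threshold_body_def
      by (rule outputs_within_mono, (rule double outputs_within_rules)+) (auto simp: min_def le_Suc_eq)
  qed
  have "k \<le> M" using M less_exp[of k] by linarith
  then have fold: "outputs_within (foldp threshold_body) (Node (enc_nat k) (Node (Node (enc_nat e) (enc_nat 2)) Leaf))
      (Node (enc_nat (e - k)) (enc_nat (2 * 2 ^ min e k))) (M * (M * (20 + 16) + 80 + 16) + 6)"
    by (intro outputs_within_foldp_nat[where st = st, OF step]) (simp_all add: st_def)
  show ?thesis unfolding threshold_prog_def
    by (rule outputs_within_mono, (rule fold outputs_within_rules)+) (simp_all add: threshold_time_def algebra_simps)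
qed

definition deficit_body :: prog where "deficit_body = Snd ;; Fst ;; Snd"

text \<open>Comparison by truncated subtraction: the result is \<open>Leaf\<close> exactly if the
  list has at least the required length, which is the acceptance test of the greedy step.\<close>

definition deficit_prog :: prog where
  "deficit_prog = Pair Fst (Pair Snd (Quote Leaf)) ;; foldp deficit_body"

definition deficit_time :: "nat \<Rightarrow> nat" where "deficit_time M = M * 50 + 50"

lemma outputs_within_deficit_prog:
  assumes "length zs \<le> M"
  shows "outputs_within deficit_prog (Node (enc_list enc zs) (enc_nat l)) (enc_nat (l - length zs)) (deficit_time M)"
proof -
  define st where "st j = enc_nat (l - j)" for j
  have step: "outputs_within deficit_body (Node (enc (zs ! j)) (Node (st j) Leaf)) (st (Suc j)) 20" for j
    unfolding deficit_body_def st_def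
    by (rule outputs_within_mono, (rule outputs_within_rules)+) simp_all
  have fold: "outputs_within (foldp deficit_body) (Node (enc_list enc zs) (Node (enc_nat l) Leaf))
      (enc_nat (l - length zs)) (M * (20 + 16) + 6)"
    by (rule outputs_within_foldp[where st = st, OF step]) (use assms in \<open>simp_all add: st_def\<close>)
  show ?thesis unfolding deficit_prog_def
    by (rule outputs_within_mono, (rule fold outputs_within_rules)+) (simp_all add: deficit_time_def)
qed

text \<open>The numeral for the threshold is decremented once per entry containing the node, so a
  nonzero remainder means that the node is still free.\<close>

definition residual_body :: prog where
  "residual_body = Cond (Pair (Snd ;; Snd) (Fst ;; Snd) ;; mem_prog) (Snd ;; Fst ;; Snd) (Snd ;; Fst)"

definition residual_prog :: prog where
  "residual_prog = Pair (Snd ;; Fst) (Pair (Snd ;; Snd) Fst) ;; foldp residual_body"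

definition residual_time :: "nat \<Rightarrow> nat" where "residual_time M = M * (mem_time M + 100) + 100"

lemma outputs_within_residual_prog:
  assumes A: "\<And>x ps. (x, ps) \<in> set A \<Longrightarrow> set ps \<subseteq> bitstrings m \<and> length ps \<le> M"
    and p: "p \<in> bitstrings m" and M: "length A \<le> M" "m \<le> M"
  shows "outputs_within residual_prog (Node (enc_bits p) (Node (enc_list enc_entry A) (enc_nat t)))
    (enc_nat (t - load A p)) (residual_time M)"
proof -
  define st where "st j = enc_nat (t - load (take j A) p)" for j
  have step: "outputs_within residual_body (Node (enc_entry (A ! j)) (Node (st j) (enc_bits p))) (st (Suc j)) (mem_time M + 60)"
    if j: "j < length A" for j
  proof -
    obtain x ps where xp: "A ! j = (x, ps)" by fastforce
    then have "(x, ps) \<in> set A" using nth_mem[OF j] by simp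
    from A[OF this] have mem: "outputs_within mem_prog (Node (enc_bits p) (enc_list enc_bits ps))
        (enc_bit (p \<in> set ps)) (mem_time M)"
      using p M by (intro outputs_within_mem_prog) (auto simp: bitstrings_def)
    show ?thesis unfolding st_def residual_body_def xp enc_entry.simps
      by (rule outputs_within_mono, (rule mem outputs_within_rules)+)
        (use j in \<open>auto simp: take_Suc_conv_app_nth xp\<close>)
  qed
  have fold: "outputs_within (foldp residual_body) (Node (enc_list enc_entry A) (Node (enc_nat t) (enc_bits p)))
      (enc_nat (t - load A p)) (M * (mem_time M + 60 + 16) + 6)"
    by (rule outputs_within_foldp[where st = st, OF step]) (use M in \<open>simp_all add: st_def\<close>)
  show ?thesis unfolding residual_prog_def
    by (rule outputs_within_mono, (rule fold outputs_within_rules)+) (simp_all add: residual_time_def algebra_simps)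
qed

section \<open>Programs that call the condenser\<close>

text \<open>With a single implicit variable, \<open>Pair q Id\<close> serves to store the value of
  \<open>q\<close> in front of the old state. Here it keeps the neighbour computed by
  \<open>P\<close> for both the test and the output.\<close>

definition free_body :: "prog \<Rightarrow> prog" where
  "free_body P = Pair (Pair (Snd ;; Snd ;; Fst) Fst ;; P) Id ;;
     Cond (Pair Fst (Pair (Snd ;; Snd ;; Snd ;; Snd ;; Fst) (Snd ;; Snd ;; Snd ;; Snd ;; Snd ;; Fst)) ;; residual_prog)
       (Pair Fst (Snd ;; Snd ;; Fst)) (Snd ;; Snd ;; Fst)"

definition free_prog :: "prog \<Rightarrow> prog" where
  "free_prog P = Pair (Snd ;; Snd ;; Snd) (Pair (Quote (enc_bits [])) Id) ;; foldp (free_body P)"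

definition free_time :: "nat \<Rightarrow> nat" where "free_time M = M * (M + residual_time M + 150) + 100"

definition greedy_body :: "prog \<Rightarrow> prog" where
  "greedy_body P = Pair (Pair Fst (Pair (Snd ;; Fst ;; Fst) (Snd ;; Snd ;; Snd)) ;; free_prog P) Id ;;
     Cond (Pair Fst (Snd ;; Snd ;; Snd ;; Fst) ;; deficit_prog)
       (Pair (Snd ;; Snd ;; Fst ;; Fst) (Pair (Snd ;; Fst) (Snd ;; Snd ;; Fst ;; Snd)))
       (Pair (Pair (Pair (Snd ;; Fst) Fst) (Snd ;; Snd ;; Fst ;; Fst)) (Snd ;; Snd ;; Fst ;; Snd))"

text \<open>\<open>foldr\<close> consumes its list from the right end and \<open>foldp\<close> from
  the left, so the list is reversed first.\<close>

definition greedy_prog :: "prog \<Rightarrow> prog" where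
  "greedy_prog P = Pair (Pair Fst (Quote (enc_bits [])) ;; revapp_prog) (Pair (Quote (Node Leaf Leaf)) Snd) ;;
     foldp (greedy_body P)"

definition greedy_time :: "nat \<Rightarrow> nat" where
  "greedy_time M = M * (free_time M + deficit_time M + 200) + revapp_time M + 100"

definition level_body :: "prog \<Rightarrow> prog" where
  "level_body P = Pair (Pair (Snd ;; Fst ;; Fst) (Snd ;; Snd) ;; greedy_prog P) Id ;;
     Pair (Fst ;; Snd) (Pair (Fst ;; Fst) (Snd ;; Snd ;; Fst ;; Snd) ;; revapp_prog)"

definition levels_prog :: "prog \<Rightarrow> prog" where
  "levels_prog P = Pair Fst (Pair (Pair (Snd ;; Fst) (Quote Leaf)) (Snd ;; Snd)) ;; foldp (level_body P)"

definition levels_time :: "nat \<Rightarrow> nat" where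
  "levels_time M = M * (greedy_time M + revapp_time M + 100) + 100"

text \<open>The chains of \<open>Snd\<close> on the first input select \<open>k\<close>,
  \<open>l\<close>, again \<open>k\<close> together with \<open>e\<close> for the threshold, and
  \<open>d\<close> from the parameter list \<open>[n, d, m, e, k, l]\<close>.\<close>

definition assignment_prog :: "prog \<Rightarrow> prog" where
  "assignment_prog P = Pair (Snd ;; Snd)
     (Pair (Fst ;; Snd ;; Snd ;; Snd ;; Snd ;; Fst)
       (Pair (Snd ;; Fst ;; dedup_prog)
         (Pair (Fst ;; Snd ;; Snd ;; Snd ;; Snd ;; Snd ;; Fst)
           (Pair (Pair (Fst ;; Snd ;; Snd ;; Snd ;; Snd ;; Fst) (Fst ;; Snd ;; Snd ;; Snd ;; Fst) ;; threshold_prog)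
             (Fst ;; Snd ;; Fst ;; bits_prog)))) ;; levels_prog P ;; Snd) ;;
     lookup_prog"

definition assignment_time :: "nat \<Rightarrow> nat" where
  "assignment_time M = dedup_time M + threshold_time M + bits_time M + levels_time M + lookup_time M + 200"

text \<open>The reversal reflects that the program collects neighbours by prepending them.\<close>

definition nbr_list :: "nat \<Rightarrow> (bool list \<Rightarrow> bool list \<Rightarrow> bool list) \<Rightarrow> bool list \<Rightarrow> bool list list" where
  "nbr_list d C x = rev (map (C x) (bits_list d))"

lemma mset_nbr_list: "mset (nbr_list d C x) = nbrs d C x"
  by (simp add: nbr_list_def nbrs_def mset_bits_list)

lemma length_nbr_list: "length (nbr_list d C x) = 2 ^ d"
  by (simp add: nbr_list_def length_bits_list)

lemma set_nbr_list:
  "maps_bitstrings n d m C \<Longrightarrow> x \<in> bitstrings n \<Longrightarrow> set (nbr_list d C x) \<subseteq> bitstrings m"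
  by (auto simp: nbr_list_def set_bits_list maps_bitstrings_def)

text \<open>
  The single number \<open>M\<close> bounds the running time of \<open>P\<close> and the lengths of all lists that
  are looped over.  Other data, such as the unary numeral for \<open>e\<close>, may be larger, because
  trees are copied in unit time.
\<close>

locale timed_map =
  fixes P :: prog and n d m :: nat and C :: "bool list \<Rightarrow> bool list \<Rightarrow> bool list" and M :: nat
  assumes maps: "maps_bitstrings n d m C"
    and run: "x \<in> bitstrings n \<Longrightarrow> y \<in> bitstrings d \<Longrightarrow>
      outputs_within P (Node (enc_bits x) (enc_bits y)) (enc_bits (C x y)) M"
    and M: "n \<le> M" "m \<le> M" "2 ^ d \<le> M"
begin

lemma outputs_within_free_prog:
  assumes A: "\<forall>(x, ps)\<in>set A. set ps \<subseteq> bitstrings m \<and> length ps \<le> M" "length A \<le> M"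
    and x: "x \<in> bitstrings n"
  shows "outputs_within (free_prog P)
    (Node (enc_bits x) (Node (enc_list enc_entry A) (Node (enc_nat t) (enc_list enc_bits (bits_list d)))))
    (enc_list enc_bits (filter (\<lambda>p. load A p < t) (nbr_list d C x))) (free_time M)"
proof -
  let ?env = "Node (enc_bits x) (Node (enc_list enc_entry A) (Node (enc_nat t) (enc_list enc_bits (bits_list d))))"
  define st where "st j = enc_list enc_bits (filter (\<lambda>p. load A p < t) (rev (map (C x) (take j (bits_list d)))))" for j
  have step: "outputs_within (free_body P) (Node (enc_bits (bits_list d ! j)) (Node (st j) ?env)) (st (Suc j))
      (M + residual_time M + 120)" if j: "j < length (bits_list d)" for j
  proof -
    have y: "bits_list d ! j \<in> bitstrings d" using nth_mem[OF j] by (simp add: set_bits_list)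
    have res: "outputs_within residual_prog (Node (enc_bits (C x (bits_list d ! j))) (Node (enc_list enc_entry A) (enc_nat t)))
      (enc_nat (t - load A (C x (bits_list d ! j)))) (residual_time M)"
      using A maps x y M by (intro outputs_within_residual_prog[where m = m]) (auto simp: maps_bitstrings_def)
    show ?thesis unfolding st_def free_body_def
      by (rule outputs_within_mono, (rule run[OF x y] res outputs_within_rules)+)
        (use j in \<open>auto simp: take_Suc_conv_app_nth\<close>)
  qed
  have fold: "outputs_within (foldp (free_body P)) (Node (enc_list enc_bits (bits_list d)) (Node (enc_bits []) ?env))
      (enc_list enc_bits (filter (\<lambda>p. load A p < t) (nbr_list d C x))) (M * (M + residual_time M + 120 + 16) + 6)"
    by (rule outputs_within_foldp[where st = st, OF step]) (use M in \<open>simp_all add: st_def nbr_list_def length_bits_list\<close>)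
  show ?thesis unfolding free_prog_def
    by (rule outputs_within_mono, (rule fold outputs_within_rules)+) (simp_all add: free_time_def algebra_simps)
qed

abbreviation enc_params :: "nat \<Rightarrow> nat \<Rightarrow> tree" where
  "enc_params l t \<equiv> Node (enc_nat l) (Node (enc_nat t) (enc_list enc_bits (bits_list d)))"

lemma outputs_within_greedy_prog:
  assumes L: "set L \<subseteq> bitstrings n" "length L \<le> M"
  shows "outputs_within (greedy_prog P) (Node (enc_list enc_bits L) (enc_params l t))
    (enc_greedy (greedy (nbr_list d C) t l L)) (greedy_time M)"
proof -
  let ?N = "nbr_list d C"
  \<comment> \<open>\<open>rev (take j (rev L))\<close> is the suffix of \<open>L\<close> of length
    \<open>j\<close>, the part treated after \<open>j\<close> iterations.\<close>
  define st where "st j = enc_greedy (greedy ?N t l (rev (take j (rev L))))" for j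
  have step: "outputs_within (greedy_body P) (Node (enc_bits (rev L ! j)) (Node (st j) (enc_params l t))) (st (Suc j))
      (free_time M + deficit_time M + 180)" if j: "j < length (rev L)" for j
  proof -
    obtain A F where g: "greedy ?N t l (rev (take j (rev L))) = (A, F)" by fastforce
    let ?x = "rev L ! j"
    have x: "?x \<in> bitstrings n" using nth_mem[OF j] L(1) by auto
    from greedy_mset[OF g] have ms: "mset (map fst A) + mset F = mset (rev (take j (rev L)))" .
    have lenA: "length A \<le> M"
      using arg_cong[OF ms, of size] L(2) by simp
    \<comment> \<open>The membership tests loop over the recorded lists. These are contained in
      neighbour lists, so \<open>2 ^ d\<close> bounds their lengths.\<close>
    have wfA: "\<forall>(z, ps)\<in>set A. set ps \<subseteq> bitstrings m \<and> length ps \<le> M"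
    proof safe
      fix z ps assume ps: "(z, ps) \<in> set A"
      have "z \<in># mset (map fst A) + mset F" using ps by force
      then have "z \<in> set (take j (rev L))" unfolding ms by simp
      then have "z \<in> set (rev L)" by (rule in_set_takeD)
      then have z: "z \<in> bitstrings n" using L(1) by auto
      from greedy_entries[OF g ps] have sub: "mset ps \<subseteq># mset (?N z)" by simp
      from set_mset_mono[OF this] size_mset_mono[OF this] set_nbr_list[OF maps z] M(3)
      show "length ps \<le> M" "\<And>p. p \<in> set ps \<Longrightarrow> p \<in> bitstrings m"
        by (auto simp: length_nbr_list)
    qed
    note free = outputs_within_free_prog[OF wfA lenA x, where t = t]
    have "length (filter (\<lambda>p. load A p < t) (?N ?x)) \<le> M"
      using length_filter_le[of _ "?N ?x"] M(3) by (metis length_nbr_list le_trans)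
    note deficit = outputs_within_deficit_prog[OF this, of enc_bits l]
    have "rev (take (Suc j) (rev L)) = ?x # rev (take j (rev L))"
      using j by (simp only: take_Suc_conv_app_nth rev_append) simp
    then have Suc: "greedy ?N t l (rev (take (Suc j) (rev L))) = greedy_step ?N t l ?x (A, F)"
      by (simp only: greedy_Cons g)
    show ?thesis unfolding st_def greedy_body_def Suc g enc_greedy.simps
      by (rule outputs_within_mono, (rule free deficit outputs_within_rules)+)
        (auto simp: Let_def)
  qed
  have rev: "outputs_within revapp_prog (Node (enc_list enc_bits L) (enc_bits [])) (enc_list enc_bits (rev L)) (revapp_time M)"
    using outputs_within_revapp_prog[OF L(2), of enc_bits "[]"] by simp
  have fold: "outputs_within (foldp (greedy_body P)) (Node (enc_list enc_bits (rev L)) (Node (Node Leaf Leaf) (enc_params l t)))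
      (enc_greedy (greedy ?N t l L)) (M * (free_time M + deficit_time M + 180 + 16) + 6)"
    by (rule outputs_within_foldp[where st = st, OF step]) (use L in \<open>simp_all add: st_def\<close>)
  show ?thesis unfolding greedy_prog_def
    by (rule outputs_within_mono, (rule fold rev outputs_within_rules)+) (simp_all add: greedy_time_def algebra_simps)
qed

lemma outputs_within_levels_prog:
  assumes S: "set S \<subseteq> bitstrings n" "length S \<le> M" and k: "k \<le> M"
  shows "outputs_within (levels_prog P) (Node (enc_nat k) (Node (enc_list enc_bits (fold List.insert S [])) (enc_params l t)))
    (enc_levels (levels (nbr_list d C) t l k S)) (levels_time M)"
proof -
  let ?N = "nbr_list d C"
  define st where "st j = enc_levels (levels ?N t l j S)" for j
  have step: "outputs_within (level_body P) (Node Leaf (Node (st j) (enc_params l t))) (st (Suc j))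
      (greedy_time M + revapp_time M + 80)" for j
  proof -
    obtain L Z where lv: "levels ?N t l j S = (L, Z)" by fastforce
    obtain A F where g: "greedy ?N t l L = (A, F)" by fastforce
    have greedy: "outputs_within (greedy_prog P) (Node (enc_list enc_bits L) (enc_params l t))
        (Node (enc_list enc_entry A) (enc_list enc_bits F)) (greedy_time M)"
      using outputs_within_greedy_prog[of L l t] levels_lengths[OF lv] S g by simp
    have "length A \<le> M"
      using arg_cong[OF greedy_mset[OF g], of size] levels_lengths[OF lv] S by simp
    note revapp = outputs_within_revapp_prog[OF this, of enc_entry Z]
    have Suc: "levels ?N t l (Suc j) S = (F, rev A @ Z)" using lv g by (simp add: levels_def)
    show ?thesis unfolding st_def level_body_def lv Suc enc_levels.simps
      by (rule outputs_within_mono, (rule greedy revapp outputs_within_rules)+) simp_all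
  qed
  have fold: "outputs_within (foldp (level_body P))
      (Node (enc_nat k) (Node (Node (enc_list enc_bits (fold List.insert S [])) Leaf) (enc_params l t)))
      (enc_levels (levels ?N t l k S)) (M * (greedy_time M + revapp_time M + 80 + 16) + 6)"
    by (rule outputs_within_foldp_nat[where st = st, OF step]) (use k in \<open>simp_all add: st_def levels_def\<close>)
  show ?thesis unfolding levels_prog_def
    by (rule outputs_within_mono, (rule fold outputs_within_rules)+) (simp_all add: levels_time_def algebra_simps)
qed

lemma outputs_within_assignment_prog:
  assumes S: "set S \<subseteq> bitstrings n" "length S \<le> 2 ^ k" and k: "2 * 2 ^ k \<le> M" and x: "x \<in> bitstrings n"
  shows "outputs_within (assignment_prog P)
    (Node (enc_list enc_nat [n, d, m, e, k, l]) (Node (enc_list enc_bits S) (enc_bits x)))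
    (enc_list enc_bits (lookup x (snd (levels (nbr_list d C) (2 * 2 ^ min e k) l k S)))) (assignment_time M)"
proof -
  obtain L Z where lv: "levels (nbr_list d C) (2 * 2 ^ min e k) l k S = (L, Z)" by fastforce
  have len: "length S \<le> M" "k \<le> M" using S(2) k less_exp[of k] by linarith+
  note dedup = outputs_within_dedup_prog[OF S(1) len(1) M(1)]
  note threshold = outputs_within_threshold_prog[OF k, of e]
  note bits = outputs_within_bits_prog[OF M(3)]
  note levels = outputs_within_levels_prog[OF S(1) len, of l "2 * 2 ^ min e k", unfolded lv enc_levels.simps]
  have lookup: "outputs_within lookup_prog (Node (enc_bits x) (enc_list enc_entry Z)) (enc_list enc_bits (lookup x Z)) (lookup_time M)"
  proof (rule outputs_within_lookup_prog)
    show "length z = length x" if "(z, ps) \<in> set Z" for z ps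
      using levels_lengths(2)[OF lv] S(1) x that by (force simp: bitstrings_def)
    show "length Z \<le> M" using levels_lengths(4)[OF lv] len by linarith
    show "length x \<le> M" using x M by (simp add: bitstrings_def)
  qed
  show ?thesis unfolding assignment_prog_def lv enc_list.simps
    by (rule outputs_within_mono, (rule dedup threshold bits levels lookup outputs_within_rules)+)
      (simp_all add: assignment_time_def)
qed

end

section \<open>Polynomial bounds\<close>

primrec height :: "tree \<Rightarrow> nat" where
  "height Leaf = 0"
| "height (Node a b) = Suc (max (height a) (height b))"

primrec quote_height :: "prog \<Rightarrow> nat" where
  "quote_height Id = 0"
| "quote_height (Quote c) = height c"
| "quote_height Fst = 0"
| "quote_height Snd = 0"
| "quote_height (Pair p q) = max (quote_height p) (quote_height q)"
| "quote_height (Seq p q) = max (quote_height p) (quote_height q)"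
| "quote_height (Cond b p q) = max (quote_height b) (max (quote_height p) (quote_height q))"
| "quote_height (While b p) = max (quote_height b) (quote_height p)"

text \<open>A quoted constant may bring in its whole height in one step, whence the maximum; apart
  from that only \<open>Pair\<close> adds height, one level at a time.\<close>

lemma runs_height: "runs p v w t \<Longrightarrow> height w \<le> max (height v) (quote_height p) + t"
  by (induction rule: runs.induct) auto

lemma length_le_height: "length xs \<le> height (enc_list f xs)"
  by (induction xs) auto

lemma height_enc_bits: "height (enc_bits x) \<le> length x + 1"
proof (induction x)
  case (Cons a x)
  have "height (enc_bit a) \<le> 1" by (cases a) simp_all
  with Cons show ?case by simp
qed simp

text \<open>
  A program can increase the height of a tree only by a constant per step.  This is why the
  output length of an explicit condenser is polynomial.
\<close>

lemma outputs_within_length_le: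
  assumes "outputs_within P (Node (enc_bits x) (enc_bits y)) (enc_bits z) T"
  shows "length z \<le> length x + length y + quote_height P + T + 2"
proof -
  obtain t where t: "t \<le> T" "runs P (Node (enc_bits x) (enc_bits y)) (enc_bits z) t"
    using assms by (auto simp: outputs_within_def)
  from runs_height[OF t(2)] length_le_height[of z enc_bit] height_enc_bits[of x] height_enc_bits[of y] t(1)
  show ?thesis by (simp add: max_def split: if_splits)
qed

section \<open>Closure properties of polynomial bounds\<close>

lemma poly_nat_mono: "a \<le> b \<Longrightarrow> poly p a \<le> poly p (b :: nat)"
  unfolding poly_altdef by (intro sum_mono mult_left_mono power_mono) simp_all

text \<open>Closure rules for this class spare writing out a polynomial for the nested time
  bounds.\<close>

definition is_polynomial :: "(nat \<Rightarrow> nat) \<Rightarrow> bool" where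
  "is_polynomial f \<longleftrightarrow> (\<exists>b. \<forall>s. f s = poly b s)"

lemma is_polynomial_poly: "is_polynomial (poly b)"
  unfolding is_polynomial_def by blast

lemma is_polynomial_const: "is_polynomial (\<lambda>_. c)"
  unfolding is_polynomial_def by (intro exI[of _ "[:c:]"]) simp

lemma is_polynomial_ident: "is_polynomial (\<lambda>s. s)"
  unfolding is_polynomial_def by (intro exI[of _ "[:0, 1:]"]) simp

lemma is_polynomial_add: "is_polynomial f \<Longrightarrow> is_polynomial g \<Longrightarrow> is_polynomial (\<lambda>s. f s + g s)"
  unfolding is_polynomial_def by (metis poly_add)

lemma is_polynomial_mult: "is_polynomial f \<Longrightarrow> is_polynomial g \<Longrightarrow> is_polynomial (\<lambda>s. f s * g s)"
  unfolding is_polynomial_def by (metis poly_mult)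

lemma is_polynomial_assignment_time:
  assumes "is_polynomial f"
  shows "is_polynomial (\<lambda>s. assignment_time (f s))"
  unfolding assignment_time_def dedup_time_def threshold_time_def bits_time_def levels_time_def
    lookup_time_def greedy_time_def revapp_time_def deficit_time_def free_time_def residual_time_def
    mem_time_def eq_time_def
  by (intro is_polynomial_add is_polynomial_mult is_polynomial_const assms)

lemma explicit_condenser_computable:
  assumes C: "\<And>n. n \<in> I \<Longrightarrow> maps_bitstrings n (d n) (m n) (C n)" and expl: "explicit_family I d C"
  shows "assignment_computable I d kmax (\<lambda>n. [n, d n, m n, e n, kmax n, l n])
    (\<lambda>n. assignment (nbr_list (d n) (C n)) (2 * 2 ^ min (e n) (kmax n)) (l n) (kmax n))"
proof -
  obtain P b where P: "\<And>n x y. n \<in> I \<Longrightarrow> x \<in> bitstrings n \<Longrightarrow> y \<in> bitstrings (d n) \<Longrightarrow>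
      outputs_within P (Node (enc_bits x) (enc_bits y)) (enc_bits (C n x y)) (poly b n)"
    using expl unfolding explicit_family_def by blast
  \<comment> \<open>\<open>2 * s\<close> dominates \<open>n\<close>, \<open>2 ^ d n\<close> and the
    \<open>2 * 2 ^ kmax n\<close> needed for the threshold, and \<open>poly b s\<close> the running
    time of \<open>P\<close>. The whole sum bounds the output length \<open>m n\<close>.\<close>
  define M where "M s = 2 * s + 2 + quote_height P + poly b s" for s
  have "is_polynomial M"
    unfolding M_def
    by (intro is_polynomial_add is_polynomial_mult is_polynomial_const is_polynomial_ident is_polynomial_poly)
  from is_polynomial_assignment_time[OF this]
  obtain B where B: "\<And>s. assignment_time (M s) = poly B s" unfolding is_polynomial_def by blast
  show ?thesis
    unfolding assignment_computable_def
  proof (intro exI[of _ "assignment_prog P"] exI[of _ B] ballI allI impI; elim conjE)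
    fix n S x assume n: "n \<in> I" and x: "x \<in> bitstrings n" and S: "set S \<subseteq> bitstrings n" "length S \<le> 2 ^ kmax n"
    define s where "s = 2 ^ kmax n + 2 ^ d n + n"
    have "poly b n \<le> poly b s" by (rule poly_nat_mono) (simp add: s_def)
    moreover have "n + d n \<le> s" unfolding s_def using less_exp[of "d n"] by (simp add: trans_le_add2)
    ultimately have le: "poly b n \<le> M s" "n + d n + quote_height P + poly b n + 2 \<le> M s"
      unfolding M_def by linarith+
    \<comment> \<open>Any seed will do: \<open>P\<close> writes an output of length
      \<open>m n\<close>, which its running time limits.\<close>
    have "m n \<le> n + d n + quote_height P + poly b n + 2"
    proof -
      obtain y where y: "y \<in> bitstrings (d n)" using bitstrings_nonempty by blast
      then have "length (C n x y) = m n" using C[OF n] x by (simp add: maps_bitstrings_def bitstrings_def)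
      then show ?thesis
        using outputs_within_length_le[OF P[OF n x y]] x y by (simp add: bitstrings_def)
    qed
    then interpret timed_map P n "d n" "m n" "C n" "M s"
      using le by unfold_locales (auto simp: M_def s_def C[OF n] intro: outputs_within_mono[OF P[OF n] refl])
    have "2 * 2 ^ kmax n \<le> M s" by (simp add: M_def s_def)
    from outputs_within_assignment_prog[OF S this x, of "e n" "l n"]
    show "\<exists>ys. mset ys = assignment (nbr_list (d n) (C n)) (2 * 2 ^ min (e n) (kmax n)) (l n) (kmax n) S x \<and>
        outputs_within (assignment_prog P)
          (Node (enc_list enc_nat [n, d n, m n, e n, kmax n, l n]) (Node (enc_list enc_bits S) (enc_bits x)))
          (enc_list enc_bits ys) (poly B (2 ^ kmax n + 2 ^ d n + n))"
      unfolding assignment_def B s_def by blast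
  qed
qed

theorem theorem2p10:
  shows "(\<forall>n d m e kmax (\<epsilon>::real) C.
            condenser_up_to n d m e kmax \<epsilon> C \<longrightarrow>
            admits_online_matching (bitstrings n) (bitstrings m) (nbrs d C)
              ((1 - 4 * \<epsilon>) * 2 ^ d) (2 * real kmax * 2 ^ e) (2 ^ kmax))
       \<and> (\<forall>(I::nat set) d m e kmax (\<epsilon>::nat \<Rightarrow> real) C.
            (\<forall>n\<in>I. condenser_up_to n (d n) (m n) (e n) (kmax n) (\<epsilon> n) (C n)) \<longrightarrow>
            explicit_family I d C \<longrightarrow>
            (\<exists>f.
              (\<forall>n\<in>I. online_assignment (bitstrings n) (bitstrings (m n)) (nbrs (d n) (C n))
                 ((1 - 4 * \<epsilon> n) * 2 ^ d n) (2 * real (kmax n) * 2 ^ e n) (2 ^ kmax n) (f n)) \<and>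
              assignment_computable I d kmax
                (\<lambda>n. [n, d n, m n, e n, kmax n, nat \<lceil>(1 - 4 * \<epsilon> n) * 2 ^ d n\<rceil>]) f))"
proof (intro conjI allI impI)
  fix n d m e kmax and \<epsilon> :: real and C
  assume "condenser_up_to n d m e kmax \<epsilon> C"
  from condenser_online_assignment[OF this mset_nbr_list]
  show "admits_online_matching (bitstrings n) (bitstrings m) (nbrs d C)
      ((1 - 4 * \<epsilon>) * 2 ^ d) (2 * real kmax * 2 ^ e) (2 ^ kmax)"
    unfolding admits_online_matching_def by blast
next
  fix I :: "nat set" and d m e kmax and \<epsilon> :: "nat \<Rightarrow> real" and C
  assume C: "\<forall>n\<in>I. condenser_up_to n (d n) (m n) (e n) (kmax n) (\<epsilon> n) (C n)"
    and expl: "explicit_family I d C"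
  \<comment> \<open>The matching bounds hold for every listing of the neighbours;
    \<open>nbr_list\<close> is the one that the program produces.\<close>
  let ?f = "\<lambda>n. assignment (nbr_list (d n) (C n)) (2 * 2 ^ min (e n) (kmax n))
    (nat \<lceil>(1 - 4 * \<epsilon> n) * 2 ^ d n\<rceil>) (kmax n)"
  show "\<exists>f. (\<forall>n\<in>I. online_assignment (bitstrings n) (bitstrings (m n)) (nbrs (d n) (C n))
             ((1 - 4 * \<epsilon> n) * 2 ^ d n) (2 * real (kmax n) * 2 ^ e n) (2 ^ kmax n) (f n)) \<and>
          assignment_computable I d kmax
            (\<lambda>n. [n, d n, m n, e n, kmax n, nat \<lceil>(1 - 4 * \<epsilon> n) * 2 ^ d n\<rceil>]) f"
  proof (intro exI[of _ ?f] conjI ballI)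
    fix n assume "n \<in> I"
    with C show "online_assignment (bitstrings n) (bitstrings (m n)) (nbrs (d n) (C n))
        ((1 - 4 * \<epsilon> n) * 2 ^ d n) (2 * real (kmax n) * 2 ^ e n) (2 ^ kmax n) (?f n)"
      by (intro condenser_online_assignment mset_nbr_list) blast
  next
    show "assignment_computable I d kmax
        (\<lambda>n. [n, d n, m n, e n, kmax n, nat \<lceil>(1 - 4 * \<epsilon> n) * 2 ^ d n\<rceil>]) ?f"
      by (rule explicit_condenser_computable[OF _ expl]) (use C in \<open>auto simp: condenser_up_to_def\<close>)
  qed
qed

end
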